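(* Let $x>0$, $n\in\mathbb{N}$ and $z\in\mathbb{C}$ with $\operatorname{Re}(z)<1$. Then \[ K_z^{(1)}(4\pi^2nx)=(2\pi\sqrt{nx})^{-z}\Big\{e^{-\frac{i\pi z}{4}}K_z\big(4\pi e^{\frac{i\pi}{4}}\sqrt{nx}\big)+e^{\frac{i\pi z}{4}}K_z\big(4\pi e^{-\frac{i\pi}{4}}\sqrt{nx}\big)\Big\}. \]
   Context: For $y>0$, $K_z^{(1)}(y):=\frac{1}{2\pi i}\int_{c-i\infty}^{c+i\infty}\Gamma(s)\cos\!\big(\frac{\pi s}{2}\big)\Gamma(s-z)\,y^{-s}\,ds$ with $c>\max\{0,\operatorname{Re}(z)\}$. $K_z(\cdot)$ on the right denotes the modified Bessel function of the second kind of order $z$. *)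

theory Defs
  imports "HOL-Complex_Analysis.Complex_Analysis"
begin

text \<open>
  The integral of \<open>f\<close> along the upward vertical line \<open>Re s = c\<close>, parametrised by
  \<open>s = c + i t\<close>, so that \<open>ds = i dt\<close>. It is a Lebesgue integral, hence only meaningful
  for absolutely convergent integrals.
\<close>
definition vertical_line_integral :: "real \<Rightarrow> (complex \<Rightarrow> complex) \<Rightarrow> complex" where
  "vertical_line_integral c f = (LINT t|lborel. f (Complex c t) * \<i>)"

text \<open>
  The kernel \<open>K_z^(1)(y)\<close> for \<open>y > 0\<close>, with the abscissa \<open>c\<close> of the line of integration as an
  explicit parameter; it is intended for \<open>c > max {0, Re z}\<close>, where the value does not depend
  on \<open>c\<close>. The integrand decays like \<open>exp (- pi |t| / 2)\<close> up to a power of \<open>|t|\<close>, so the integral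
  converges absolutely.
\<close>
definition K1 :: "real \<Rightarrow> complex \<Rightarrow> real \<Rightarrow> complex" where
  "K1 c z y = 1 / (2 * of_real pi * \<i>) *
     vertical_line_integral c
       (\<lambda>s. Gamma s * cos (of_real pi * s / 2) * Gamma (s - z) * of_real y powr (- s))"

text \<open>
  The modified Bessel function of the first kind, with the principal branch of the power.
  The reciprocal Gamma function \<^const>\<open>rGamma\<close> vanishes at the poles of \<^const>\<open>Gamma\<close>, so the
  series is also correct for negative integer orders.
\<close>
definition bessel_I :: "complex \<Rightarrow> complex \<Rightarrow> complex" where
  "bessel_I \<nu> w =
     (w / 2) powr \<nu> * (\<Sum>k. (w\<^sup>2 / 4) ^ k * rGamma (\<nu> + of_nat k + 1) / fact k)"

text \<open>
  The modified Bessel function of the second kind (principal branch); at integer orders, where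
  the quotient is 0/0, it is defined by the limit in the order.
\<close>
definition bessel_K :: "complex \<Rightarrow> complex \<Rightarrow> complex" where
  "bessel_K \<nu> w =
     (let Q = (\<lambda>\<mu>. of_real pi / 2 * (bessel_I (- \<mu>) w - bessel_I \<mu> w) / sin (of_real pi * \<mu>))
      in if \<nu> \<in> \<int> then Lim (at \<nu>) Q else Q \<nu>)"

end

theory Submission
  imports Defs
begin

text \<open>
  Writing \<open>cos (\<pi>s/2)\<close> as a sum of two exponentials splits \<open>K_z^(1)(y)\<close> into two Mellin--Barnes
  integrals of \<open>\<Gamma>(s) \<Gamma>(s - z) e^(-Ls)\<close> with \<open>L = ln y \<plusminus> i\<pi>/2\<close>. Each of them equals
  \<open>4\<pi>i e^(-Lz/2) K_z(2 e^(L/2))\<close>: for \<open>z \<notin> \<int>\<close>, moving the line of integration to \<open>-\<infinity>\<close> picks up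
  the residues at \<open>s = -k\<close> and \<open>s = z - k\<close>, which by the reflection formula are the terms of the
  series for \<open>I_z\<close> and \<open>I_(-z)\<close>; for \<open>z \<in> \<int>\<close> both sides are limits in the order, as the integral
  depends continuously on \<open>z\<close>. Convergence only needs that \<open>\<Gamma>\<close> decays on vertical lines like
  \<open>e^(-\<theta>|t|)\<close> for some \<open>\<theta> > \<pi>/4\<close>. On the shifted lines, the recursion of \<open>\<Gamma>\<close> gives a factor
  \<open>e^(N Re L)\<close> divided by two Pochhammer symbols of length \<open>N\<close>, which tends to \<open>0\<close>.
\<close>

section \<open>Decay of the Gamma function on vertical lines\<close>

text \<open>Factor by factor, the quotient
  \<open>|r + k + it| / (r + k) = sqrt (1 + t^2 / (r + k)^2)\<close> decreases in
  \<open>r > 0\<close>. Cross-multiplication keeps the induction free of divisions.\<close>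

lemma pochhammer_norm_ratio_le:
  fixes \<sigma> \<tau> t :: real
  assumes "0 < \<sigma>" "\<sigma> \<le> \<tau>"
  shows "norm (pochhammer (Complex \<tau> t) n) * pochhammer \<sigma> n \<le>
         norm (pochhammer (Complex \<sigma> t) n) * pochhammer \<tau> n"
proof (induction n)
  case (Suc n)
  define a b where "a = \<sigma> + real n" and "b = \<tau> + real n"
  have ab: "0 < a" "a \<le> b" using assms by (auto simp: a_def b_def)
  have "t\<^sup>2 * a\<^sup>2 \<le> t\<^sup>2 * b\<^sup>2"
    using ab by (intro mult_left_mono power_mono) auto
  hence "(b\<^sup>2 + t\<^sup>2) * a\<^sup>2 \<le> (a\<^sup>2 + t\<^sup>2) * b\<^sup>2"
    by (simp add: algebra_simps)
  hence "sqrt ((b\<^sup>2 + t\<^sup>2) * a\<^sup>2) \<le> sqrt ((a\<^sup>2 + t\<^sup>2) * b\<^sup>2)" by simp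
  hence *: "norm (Complex b t) * a \<le> norm (Complex a t) * b"
    using ab by (simp add: real_sqrt_mult cmod_def)
  have "norm (pochhammer (Complex \<tau> t) (Suc n)) * pochhammer \<sigma> (Suc n) =
        (norm (pochhammer (Complex \<tau> t) n) * pochhammer \<sigma> n) * (norm (Complex b t) * a)"
    by (simp add: pochhammer_rec' norm_mult a_def b_def Complex_eq add_ac)
  also have "\<dots> \<le> (norm (pochhammer (Complex \<sigma> t) n) * pochhammer \<tau> n) * (norm (Complex a t) * b)"
    using assms ab by (intro mult_mono Suc.IH *) (auto intro!: mult_nonneg_nonneg pochhammer_nonneg)
  also have "\<dots> = norm (pochhammer (Complex \<sigma> t) (Suc n)) * pochhammer \<tau> (Suc n)"
    by (simp add: pochhammer_rec' norm_mult a_def b_def Complex_eq add_ac)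
  finally show ?case .
qed simp

text \<open>
  By Euler's limit formula, \<open>|\<Gamma>(\<sigma> + it)| / \<Gamma>(\<sigma>)\<close> is increasing in \<open>\<sigma>\<close>; comparing with an
  integer \<open>\<sigma>\<close>, where \<open>|\<Gamma>(\<sigma> + it)|\<close> is explicit, avoids Stirling's formula.
\<close>

lemma norm_Gamma_ratio_le:
  fixes \<sigma> \<tau> t :: real
  assumes "0 < \<sigma>" "\<sigma> \<le> \<tau>"
  shows "norm (Gamma (Complex \<sigma> t)) * Gamma \<tau> \<le> norm (Gamma (Complex \<tau> t)) * Gamma \<sigma>"
proof (rule LIMSEQ_le)
  show "(\<lambda>n. norm (Gamma_series (Complex \<sigma> t) n) * Gamma_series \<tau> n) \<longlonglongrightarrow>
          norm (Gamma (Complex \<sigma> t)) * Gamma \<tau>"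
    by (intro tendsto_intros)
  show "(\<lambda>n. norm (Gamma_series (Complex \<tau> t) n) * Gamma_series \<sigma> n) \<longlonglongrightarrow>
          norm (Gamma (Complex \<tau> t)) * Gamma \<sigma>"
    by (intro tendsto_intros)
  have "norm (Gamma_series (Complex \<sigma> t) n) * Gamma_series \<tau> n \<le>
        norm (Gamma_series (Complex \<tau> t) n) * Gamma_series \<sigma> n" for n
  proof -
    \<comment> \<open>Since \<open>|n^(it)| = 1\<close>, the factorials and powers of
      \<open>n\<close> contribute the same \<open>?K\<close> to both sides; only the Pochhammer
      symbols differ.\<close>
    let ?K = "(fact n)\<^sup>2 * exp (\<sigma> * ln n) * exp (\<tau> * ln n)"
    have nz: "pochhammer (Complex r t) (Suc n) \<noteq> 0" if "r > 0" for r
      using that unfolding pochhammer_eq_0_iff by (auto simp: complex_eq_iff)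
    have pos: "pochhammer r (Suc n) > 0" if "r > 0" for r :: real
      using that by (rule pochhammer_pos)
    note facts = nz[of \<sigma>] nz[of \<tau>] pos[of \<sigma>] pos[of \<tau>]
    have "norm (Gamma_series (Complex \<sigma> t) n) * Gamma_series \<tau> n =
          ?K / (norm (pochhammer (Complex \<sigma> t) (Suc n)) * pochhammer \<tau> (Suc n))"
      by (simp add: Gamma_series_def norm_divide norm_mult power2_eq_square)
    also have "\<dots> \<le> ?K / (norm (pochhammer (Complex \<tau> t) (Suc n)) * pochhammer \<sigma> (Suc n))"
      using facts assms by (intro divide_left_mono pochhammer_norm_ratio_le mult_pos_pos) auto
    also have "\<dots> = norm (Gamma_series (Complex \<tau> t) n) * Gamma_series \<sigma> n"
      by (simp add: Gamma_series_def norm_divide norm_mult power2_eq_square)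
    finally show ?thesis .
  qed
  thus "\<exists>N. \<forall>n\<ge>N. norm (Gamma_series (Complex \<sigma> t) n) * Gamma_series \<tau> n \<le>
          norm (Gamma_series (Complex \<tau> t) n) * Gamma_series \<sigma> n" by blast
qed

section \<open>Explicit bounds at integer real part and their transfer to strips\<close>

text \<open>Conjugation turns the square into \<open>\<Gamma>(1 + it) \<Gamma>(1 - it)\<close>;
  pulling out the factor \<open>it\<close> leaves the reflection formula at \<open>it\<close>, where
  \<open>sin (i\<pi>t) = i sinh (\<pi>t)\<close>.\<close>

lemma norm_Gamma_1_plus_ii:
  fixes t :: real
  assumes "t \<noteq> 0"
  shows "(norm (Gamma (Complex 1 t)))\<^sup>2 = pi * t / sinh (pi * t)"
proof -
  have z: "Complex 1 t = \<i> * of_real t + 1" "Complex 1 (-t) = 1 - \<i> * of_real t"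
    by (simp_all add: complex_eq_iff)
  have "complex_of_real ((norm (Gamma (Complex 1 t)))\<^sup>2) = Gamma (Complex 1 t) * Gamma (Complex 1 (-t))"
    by (subst complex_norm_square) (simp add: cnj_Gamma complex_cnj)
  also have "\<dots> = Gamma (\<i> * of_real t + 1) * Gamma (1 - \<i> * of_real t)" by (simp only: z)
  also have "Gamma (\<i> * of_real t + 1) = \<i> * of_real t * Gamma (\<i> * of_real t)"
    using assms by (intro Gamma_plus1) (auto elim!: nonpos_Ints_cases simp: complex_eq_iff)
  also have "\<i> * of_real t * Gamma (\<i> * of_real t) * Gamma (1 - \<i> * of_real t) =
             \<i> * of_real t * (of_real pi / sin (of_real pi * (\<i> * of_real t)))"
    by (simp only: mult.assoc Gamma_reflection_complex)
  also have "of_real pi * (\<i> * of_real t) = \<i> * of_real (pi * t)" by simp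
  also have "sin (\<i> * of_real (pi * t)) = \<i> * of_real (sinh (pi * t))"
    by (simp add: sin_exp_eq sinh_field_def exp_of_real[symmetric] del: exp_of_real of_real_mult)
       (simp add: field_simps flip: exp_of_real)
  also have "\<i> * of_real t * (of_real pi / (\<i> * of_real (sinh (pi * t)))) =
              of_real (pi * t / sinh (pi * t))" by simp
  finally show ?thesis by (simp only: of_real_eq_iff)
qed

text \<open>With \<open>x = \<pi>|t|\<close>, bounding \<open>x / sinh x\<close> in this way amounts
  to \<open>1 + 2x \<le> e^(2x)\<close>.\<close>

lemma norm_Gamma_1_plus_ii_le:
  fixes t :: real
  shows "(norm (Gamma (Complex 1 t)))\<^sup>2 \<le> (1 + 2 * pi * \<bar>t\<bar>) * exp (- (pi * \<bar>t\<bar>))"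
proof (cases "t = 0")
  case True
  hence "Complex 1 t = 1" by (simp add: complex_eq_iff)
  thus ?thesis using True by simp
next
  case False
  define x where "x = pi * \<bar>t\<bar>"
  have x: "x > 0" using False by (simp add: x_def)
  have "(norm (Gamma (Complex 1 t)))\<^sup>2 = x / sinh x"
    unfolding norm_Gamma_1_plus_ii[OF False] x_def by (auto simp: abs_if)
  also have "\<dots> \<le> (1 + 2 * x) * exp (- x)"
  proof -
    have "1 + 2 * x \<le> exp (2 * x)" by (rule exp_ge_add_one_self)
    hence "2 * x * exp (2 * x) \<le> (1 + 2 * x) * (exp (2 * x) - 1)" by (simp add: algebra_simps)
    hence "(2 * x * exp (2 * x)) * exp (-2 * x) \<le> ((1 + 2 * x) * (exp (2 * x) - 1)) * exp (-2 * x)"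
      by (intro mult_right_mono) auto
    hence "x \<le> (1 + 2 * x) * exp (- x) * ((exp x - exp (-x)) / 2)"
      by (simp add: field_simps flip: exp_add)
    thus ?thesis using x by (simp add: field_simps sinh_field_def)
  qed
  finally show ?thesis by (simp add: x_def mult_ac)
qed

text \<open>A single term of the exponential series is at most its sum. This absorbs polynomial
  factors at the cost of an arbitrarily small exponential rate \<open>a\<close>.\<close>

lemma power_le_exp:
  fixes a c :: real
  assumes "a > 0" "c \<ge> 0"
  shows "\<exists>C. \<forall>x\<ge>0. (c + x) ^ k \<le> C * exp (a * x)"
proof (intro exI allI impI)
  fix x :: real assume x: "x \<ge> 0"
  have "(a * (c + x)) ^ k / fact k = (\<Sum>n\<in>{k}. (a * (c + x)) ^ n / fact n)" by simp
  also have "\<dots> \<le> (\<Sum>n. (a * (c + x)) ^ n / fact n)"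
    using assms x summable_exp_generic[of "a * (c + x)"]
    by (intro sum_le_suminf) (auto simp: field_simps)
  also have "\<dots> = exp (a * (c + x))" by (simp add: exp_def field_simps)
  finally have "(c + x) ^ k \<le> fact k / a ^ k * exp (a * (c + x))"
    using assms by (simp add: power_mult_distrib pos_le_divide_eq pos_divide_le_eq mult.commute)
  thus "(c + x) ^ k \<le> fact k / a ^ k * exp (a * c) * exp (a * x)"
    by (simp add: algebra_simps exp_add)
qed

text \<open>The recursion writes the value as \<open>\<Gamma>(1 + it)\<close> times \<open>m\<close>
  factors of modulus at most \<open>m + 1 + |t|\<close>; the last power and the 7 come from bounding
  \<open>\<Gamma>(1 + it)\<close>.\<close>

lemma norm_Gamma_Suc_plus_ii_le:
  "norm (Gamma (Complex (real (Suc m)) t)) \<le>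
     7 * (real (Suc m) + \<bar>t\<bar>) ^ Suc m * exp (- (pi / 2 * \<bar>t\<bar>))"
proof -
  let ?z = "Complex 1 t"
  have z: "?z \<notin> \<int>\<^sub>\<le>\<^sub>0" by (auto elim!: nonpos_Ints_cases simp: complex_eq_iff)
  hence nz: "Gamma ?z \<noteq> 0" by (simp add: Gamma_eq_zero_iff)
  have "Complex (real (Suc m)) t = ?z + of_nat m" by (simp add: complex_eq_iff)
  hence "Gamma (Complex (real (Suc m)) t) = pochhammer ?z m * Gamma ?z"
    using pochhammer_Gamma[OF z, of m] nz by simp
  moreover have "norm (pochhammer ?z m) \<le> (real (Suc m) + \<bar>t\<bar>) ^ m"
  proof -
    have "norm (pochhammer ?z m) = (\<Prod>i<m. norm (?z + of_nat i))"
      by (simp add: pochhammer_prod prod_norm atLeast0LessThan)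
    also have "\<dots> \<le> (\<Prod>i<m. real (Suc m) + \<bar>t\<bar>)"
    proof (intro prod_mono conjI)
      fix i assume "i \<in> {..<m}"
      thus "norm (?z + of_nat i) \<le> real (Suc m) + \<bar>t\<bar>"
        using cmod_le[of "?z + of_nat i"] by simp
    qed auto
    finally show ?thesis by simp
  qed
  moreover have "norm (Gamma ?z) \<le> 7 * (real (Suc m) + \<bar>t\<bar>) * exp (- (pi / 2 * \<bar>t\<bar>))"
  proof (rule power2_le_imp_le)
    \<comment> \<open>The 7 exceeds \<open>2\<pi>\<close>. Squaring a number that is at least 1 only
      enlarges it, so no square root has to be estimated.\<close>
    have "1 + 2 * pi * \<bar>t\<bar> \<le> 7 * (real (Suc m) + \<bar>t\<bar>)"
      using pi_less_4 pi_approx mult_right_mono[of "2*pi" 7 "\<bar>t\<bar>"] by (simp add: algebra_simps)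
    also have "\<dots> \<le> (7 * (real (Suc m) + \<bar>t\<bar>))\<^sup>2"
      by (intro self_le_power) auto
    finally have "(1 + 2 * pi * \<bar>t\<bar>) * exp (- (pi * \<bar>t\<bar>)) \<le>
                  (7 * (real (Suc m) + \<bar>t\<bar>))\<^sup>2 * exp (- (pi * \<bar>t\<bar>))"
      by (intro mult_right_mono) auto
    also have "\<dots> = (7 * (real (Suc m) + \<bar>t\<bar>) * exp (- (pi / 2 * \<bar>t\<bar>)))\<^sup>2"
      by (simp add: power_mult_distrib flip: exp_double)
    finally show "(norm (Gamma ?z))\<^sup>2 \<le> \<dots>" using norm_Gamma_1_plus_ii_le[of t] by linarith
  qed auto
  ultimately have "norm (Gamma (Complex (real (Suc m)) t)) \<le>
      (real (Suc m) + \<bar>t\<bar>) ^ m * (7 * (real (Suc m) + \<bar>t\<bar>) * exp (- (pi / 2 * \<bar>t\<bar>)))"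
    by (simp add: norm_mult mult_mono)
  also have "\<dots> = 7 * (real (Suc m) + \<bar>t\<bar>) ^ Suc m * exp (- (pi / 2 * \<bar>t\<bar>))"
    unfolding power_Suc by (simp only: mult_ac)
  finally show ?thesis .
qed

text \<open>The ratio bound compares \<open>Re s\<close> with an integer \<open>M \<ge> b\<close>,
  where the decay is explicit. Real \<open>\<Gamma>\<close> is bounded on \<open>[a, b]\<close> by
  compactness, and the gap \<open>\<pi>/2 - \<theta>\<close> pays for the polynomial factor.\<close>

lemma Gamma_vertical_decay:
  fixes a b \<theta> :: real
  assumes "0 < a" "\<theta> < pi / 2"
  shows "\<exists>C>0. \<forall>s. a \<le> Re s \<and> Re s \<le> b \<longrightarrow> norm (Gamma s) \<le> C * exp (- (\<theta> * \<bar>Im s\<bar>))"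
proof -
  obtain m :: nat where m: "b \<le> real (Suc m)"
    using real_arch_simple[of b] by (metis le_SucI of_nat_le_iff order_trans order_refl)
  define M where "M = real (Suc m)"
  obtain C where C: "\<And>x. x \<ge> 0 \<Longrightarrow> (M + x) ^ Suc m \<le> C * exp ((pi / 2 - \<theta>) * x)"
    using power_le_exp[of "pi / 2 - \<theta>" M "Suc m"] assms by (auto simp: M_def)
  have "compact (Gamma ` {a..b})"
    using assms by (intro compact_continuous_image continuous_on_Gamma) (auto elim!: nonpos_Ints_cases)
  then obtain B where B: "B > 0" "\<And>x. x \<in> {a..b} \<Longrightarrow> norm (Gamma x :: real) \<le> B"
    using compact_imp_bounded[of "Gamma ` {a..b} :: real set"] by (auto simp: bounded_pos)
  have GM: "Gamma M > 0" by (auto simp: M_def intro!: Gamma_real_pos)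
  have C0: "C > 0"
  proof -
    have "0 < (M + 0) ^ Suc m" by (auto simp: M_def)
    thus ?thesis using C[of 0] by simp
  qed
  show ?thesis
  proof (intro exI[of _ "B / Gamma M * (7 * C)"] allI impI conjI)
    show "B / Gamma M * (7 * C) > 0" using B GM C0 by simp
    fix s :: complex assume s: "a \<le> Re s \<and> Re s \<le> b"
    define t where "t = Im s"
    have E: "exp ((pi / 2 - \<theta>) * \<bar>t\<bar>) * exp (- (pi / 2 * \<bar>t\<bar>)) = exp (- (\<theta> * \<bar>t\<bar>))"
      by (simp add: algebra_simps flip: exp_add)
    have "norm (Gamma s) * Gamma M \<le> norm (Gamma (Complex M t)) * Gamma (Re s)"
      using norm_Gamma_ratio_le[of "Re s" M t] s assms m by (simp add: M_def t_def)
    also have "norm (Gamma (Complex M t)) \<le> 7 * (M + \<bar>t\<bar>) ^ Suc m * exp (- (pi / 2 * \<bar>t\<bar>))"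
      unfolding M_def by (rule norm_Gamma_Suc_plus_ii_le)
    also have "\<dots> \<le> 7 * (C * exp ((pi / 2 - \<theta>) * \<bar>t\<bar>)) * exp (- (pi / 2 * \<bar>t\<bar>))"
      by (intro mult_right_mono mult_left_mono C) auto
    also have "\<dots> = 7 * C * exp (- (\<theta> * \<bar>t\<bar>))" by (simp only: mult.assoc E)
    finally have "norm (Gamma s) * Gamma M \<le> 7 * C * exp (- (\<theta> * \<bar>t\<bar>)) * Gamma (Re s)"
      using s assms by (simp add: mult_right_mono Gamma_real_pos less_imp_le)
    also have "\<dots> \<le> 7 * C * exp (- (\<theta> * \<bar>t\<bar>)) * B"
      using B(2)[of "Re s"] s C0 by (intro mult_left_mono) auto
    finally show "norm (Gamma s) \<le> B / Gamma M * (7 * C) * exp (- (\<theta> * \<bar>Im s\<bar>))"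
      using GM by (simp add: field_simps t_def)
  qed
qed

text \<open>The recursion moves the strip to the right half-plane. For \<open>|Im s| \<ge> 1\<close>
  no pole is met and every factor of \<open>pochhammer s N\<close> has modulus at least 1, so
  \<open>|\<Gamma>(s)| \<le> |\<Gamma>(s + N)|\<close>.\<close>

lemma Gamma_vertical_decay_strip:
  fixes a b \<theta> :: real
  assumes "\<theta> < pi / 2"
  shows "\<exists>C>0. \<forall>s. a \<le> Re s \<and> Re s \<le> b \<and> \<bar>Im s\<bar> \<ge> 1 \<longrightarrow>
           norm (Gamma s) \<le> C * exp (- (\<theta> * \<bar>Im s\<bar>))"
proof -
  obtain N :: nat where N: "- a < real N" using reals_Archimedean2 by blast
  obtain C where C: "C > 0" "\<And>s. a + N \<le> Re s \<Longrightarrow> Re s \<le> b + N \<Longrightarrow>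
      norm (Gamma s) \<le> C * exp (- (\<theta> * \<bar>Im s\<bar>))"
    using Gamma_vertical_decay[of "a + N" \<theta> "b + N"] N assms by auto
  show ?thesis
  proof (intro exI[of _ C] conjI C(1) allI impI)
    fix s assume s: "a \<le> Re s \<and> Re s \<le> b \<and> \<bar>Im s\<bar> \<ge> 1"
    hence "s \<notin> \<int>\<^sub>\<le>\<^sub>0" by (auto elim!: nonpos_Ints_cases simp: complex_eq_iff)
    hence "Gamma (s + of_nat N) = pochhammer s N * Gamma s"
      using pochhammer_Gamma[of s N] by (simp add: Gamma_eq_zero_iff)
    moreover have "1 \<le> norm (pochhammer s N)"
    proof -
      have "1 \<le> norm (s + of_nat i)" for i
        using abs_Im_le_cmod[of "s + of_nat i"] s by simp
      thus ?thesis by (auto simp: pochhammer_prod intro!: prod_ge_1 simp flip: prod_norm)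
    qed
    ultimately have "norm (Gamma s) \<le> norm (Gamma (s + of_nat N))"
      by (simp add: norm_mult mult_le_cancel_right1)
    also have "\<dots> \<le> C * exp (- (\<theta> * \<bar>Im s\<bar>))"
      using C(2)[of "s + of_nat N"] s by simp
    finally show "norm (Gamma s) \<le> \<dots>" .
  qed
qed

section \<open>Shifting vertical lines of integration\<close>

lemma integrable_exp_neg_abs:
  fixes k :: real
  assumes "k > 0"
  shows "integrable lborel (\<lambda>t. exp (- (k * \<bar>t\<bar>)))"
proof -
  have "((\<lambda>t. - exp (- (k * t)) / k) \<longlongrightarrow> 0) at_top" using assms by real_asymp
  hence "(\<integral>\<^sup>+t. ennreal (exp (- (k * t))) * indicator {0..} t \<partial>lborel) = ennreal (0 - (- exp (- (k * 0)) / k))"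
    using assms by (intro nn_integral_FTC_atLeast) (auto intro!: derivative_eq_intros)
  also have "(\<integral>\<^sup>+t. ennreal (exp (- (k * t))) * indicator {0..} t \<partial>lborel) =
             (\<integral>\<^sup>+t. ennreal (indicator {0..} t *\<^sub>R exp (- (k * \<bar>t\<bar>))) \<partial>lborel)"
    by (intro nn_integral_cong) (auto simp: indicator_def)
  finally have "has_bochner_integral lborel (\<lambda>t. indicator {0..} t *\<^sub>R exp (- (k * \<bar>t\<bar>))) (1 / k)"
    using assms by (intro has_bochner_integral_nn_integral) auto
  from has_bochner_integral_even_function[OF this] show ?thesis
    by (simp add: has_bochner_integral_iff)
qed

lemma integrable_exp_decay:
  fixes g :: "real \<Rightarrow> complex"
  assumes "k > 0" "continuous_on UNIV g"
    and decay: "\<And>t. \<bar>t\<bar> \<ge> T \<Longrightarrow> norm (g t) \<le> C * exp (- (k * \<bar>t\<bar>))"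
  shows "integrable lborel g"
proof -
  have "compact (g ` {-T..T})"
    by (intro compact_continuous_image continuous_on_subset[OF assms(2)]) auto
  then obtain B where B: "B > 0" "\<And>t. t \<in> {-T..T} \<Longrightarrow> norm (g t) \<le> B"
    using compact_imp_bounded[of "g ` {-T..T}"] by (auto simp: bounded_pos)
  show ?thesis
  proof (rule Bochner_Integration.integrable_bound)
    show "integrable lborel (\<lambda>t. \<bar>C\<bar> * exp (- (k * \<bar>t\<bar>)) + B * indicator {-T..T} t)"
      using integrable_exp_neg_abs[OF assms(1)]
      by (intro Bochner_Integration.integrable_add integrable_mult_right) (auto intro!: integrable_real_indicator emeasure_bounded_finite)
    show "g \<in> borel_measurable lborel"
      using borel_measurable_continuous_onI[OF assms(2)] by simp
    show "AE t in lborel. norm (g t) \<le> norm (\<bar>C\<bar> * exp (- (k * \<bar>t\<bar>)) + B * indicator {-T..T} t)"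
    proof (intro AE_I2)
      fix t :: real
      have "norm (g t) \<le> \<bar>C\<bar> * exp (- (k * \<bar>t\<bar>)) + B * indicator {-T..T} t"
      proof (cases "\<bar>t\<bar> \<ge> T")
        case True
        have "norm (g t) \<le> \<bar>C\<bar> * exp (- (k * \<bar>t\<bar>))"
          by (rule order_trans[OF decay[OF True]]) (auto intro!: mult_right_mono)
        thus ?thesis using B(1) by (auto simp: indicator_def)
      next
        case False
        hence "t \<in> {-T..T}" by auto
        thus ?thesis using B(2)[of t] by (auto intro!: add_increasing)
      qed
      thus "norm (g t) \<le> norm (\<bar>C\<bar> * exp (- (k * \<bar>t\<bar>)) + B * indicator {-T..T} t)"
        by simp
    qed
  qed
qed

text \<open>Contour integrals along vertical segments arrive as gauge integrals over bounded
  intervals; dominated convergence links them to the Lebesgue integral over the line.\<close>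

lemma integral_Icc_symmetric_tendsto:
  fixes g :: "real \<Rightarrow> complex"
  assumes "integrable lborel g"
  shows "(\<lambda>n. integral {- real n..real n} g) \<longlonglongrightarrow> (LINT t|lborel. g t)"
proof -
  have "(\<lambda>n. LINT t|lborel. indicator {- real n..real n} t *\<^sub>R g t) \<longlonglongrightarrow> (LINT t|lborel. g t)"
  proof (rule integral_dominated_convergence[where w = "\<lambda>t. norm (g t)"])
    show "AE t in lborel. (\<lambda>n. indicator {- real n..real n} t *\<^sub>R g t) \<longlonglongrightarrow> g t"
    proof (intro AE_I2)
      fix t :: real
      have "eventually (\<lambda>n. real n \<ge> \<bar>t\<bar>) sequentially"
        using filterlim_real_sequentially unfolding filterlim_at_top by blast
      hence "eventually (\<lambda>n. indicator {- real n..real n} t *\<^sub>R g t = g t) sequentially"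
        by eventually_elim (auto simp: indicator_def)
      thus "(\<lambda>n. indicator {- real n..real n} t *\<^sub>R g t) \<longlonglongrightarrow> g t"
        by (rule tendsto_eventually)
    qed
  qed (use assms in \<open>auto simp: indicator_def\<close>)
  moreover have "(LINT t|lborel. indicator {- real n..real n} t *\<^sub>R g t) = integral {- real n..real n} g" for n
  proof -
    have "set_integrable lborel {- real n..real n} g"
      unfolding set_integrable_def using assms by (intro integrable_mult_indicator) auto
    from set_borel_integral_eq_integral(2)[OF this] show ?thesis
      by (simp add: set_lebesgue_integral_def)
  qed
  ultimately show ?thesis by simp
qed

text \<open>Residue theorem on the rectangle with corners \<open>a - in\<close> and
  \<open>b + in\<close>: the decay kills the horizontal sides as \<open>n\<close> grows. Since
  \<open>ds = i dt\<close>, the factor is \<open>2\<pi>\<close> rather than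
  \<open>2\<pi>i\<close>.\<close>

lemma vertical_line_shift:
  fixes f :: "complex \<Rightarrow> complex" and a b :: real
  assumes "a < b" "k > 0" and U: "open U" "connected U" "{s. a \<le> Re s \<and> Re s \<le> b} \<subseteq> U"
    and pts: "finite pts" "\<And>p. p \<in> pts \<Longrightarrow> Re p \<noteq> a \<and> Re p \<noteq> b"
    and holo: "f holomorphic_on U - pts"
    and decay: "\<And>s. a \<le> Re s \<Longrightarrow> Re s \<le> b \<Longrightarrow> \<bar>Im s\<bar> \<ge> T \<Longrightarrow> norm (f s) \<le> C * exp (- (k * \<bar>Im s\<bar>))"
  shows "(LINT t|lborel. f (Complex b t)) - (LINT t|lborel. f (Complex a t)) =
           2 * of_real pi * (\<Sum>p | p \<in> pts \<and> a < Re p \<and> Re p < b. residue f p)"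
proof -
  define S where "S = (\<Sum>p | p \<in> pts \<and> a < Re p \<and> Re p < b. residue f p)"
  \<comment> \<open>\<open>H t\<close> is the horizontal side at height \<open>t\<close>, later
    taken at \<open>n\<close> and \<open>-n\<close>.\<close>
  define H where "H = (\<lambda>t. contour_integral (linepath (Complex a t) (Complex b t)) f)"
  have cont: "continuous_on (U - pts) f" by (rule holomorphic_on_imp_continuous_on[OF holo])
  have int: "integrable lborel (\<lambda>t. f (Complex r t))" if "r \<in> {a, b}" for r
  proof (rule integrable_exp_decay[OF \<open>k > 0\<close>])
    show "continuous_on UNIV (\<lambda>t. f (Complex r t))"
      using that pts(2)[of "Complex r t" for t] U(3) assms(1)
      by (intro continuous_on_compose2[OF cont])
         (auto intro!: continuous_intros simp: subset_iff continuous_on_Complex simp flip: Complex_eq dest!: pts(2))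
    show "norm (f (Complex r t)) \<le> C * exp (- (k * \<bar>t\<bar>))" if "\<bar>t\<bar> \<ge> T" for t
      using decay[of "Complex r t"] that \<open>r \<in> {a, b}\<close> assms(1) by auto
  qed
  obtain T1 where T1: "\<And>p. p \<in> pts \<Longrightarrow> \<bar>Im p\<bar> \<le> T1"
    using finite_imp_bounded[of "Im ` pts"] pts(1) by (auto simp: bounded_iff)
  have H_lim: "(\<lambda>n. H (s * real n)) \<longlonglongrightarrow> 0" if "s \<in> {-1, 1}" for s
  proof (rule Lim_null_comparison)
    have "eventually (\<lambda>n. real n \<ge> max T (T1 + 1)) sequentially"
      using filterlim_real_sequentially unfolding filterlim_at_top by blast
    thus "eventually (\<lambda>n. norm (H (s * real n)) \<le> \<bar>C\<bar> * exp (- (k * real n)) * (b - a)) sequentially"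
    proof eventually_elim
      case (elim n)
      have seg: "a \<le> Re w \<and> Re w \<le> b \<and> \<bar>Im w\<bar> = real n"
        if "w \<in> closed_segment (Complex a (s * real n)) (Complex b (s * real n))" for w
        using that \<open>s \<in> {-1, 1}\<close> assms(1)
        by (auto simp: closed_segment_same_Im closed_segment_eq_real_ivl)
      have "norm (contour_integral (linepath (Complex a (s * real n)) (Complex b (s * real n))) f) \<le>
              \<bar>C\<bar> * exp (- (k * real n)) * norm (Complex b (s * real n) - Complex a (s * real n))"
      proof (rule contour_integral_bound_linepath)
        show "f contour_integrable_on linepath (Complex a (s * real n)) (Complex b (s * real n))"
          using seg elim T1 U(3)
          by (intro contour_integrable_continuous_linepath continuous_on_subset[OF cont]) fastforce
        show "norm (f w) \<le> \<bar>C\<bar> * exp (- (k * real n))"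
          if "w \<in> closed_segment (Complex a (s * real n)) (Complex b (s * real n))" for w
        proof -
          have "norm (f w) \<le> C * exp (- (k * \<bar>Im w\<bar>))"
            using seg[OF that] elim by (intro decay) auto
          also have "\<dots> \<le> \<bar>C\<bar> * exp (- (k * \<bar>Im w\<bar>))" by (intro mult_right_mono) auto
          finally show ?thesis using seg[OF that] by simp
        qed
      qed auto
      moreover have "Complex b (s * real n) - Complex a (s * real n) = of_real (b - a)"
        by (simp add: complex_eq_iff)
      ultimately show ?case using assms(1) by (simp add: H_def del: of_real_diff)
    qed
    show "(\<lambda>n. \<bar>C\<bar> * exp (- (k * real n)) * (b - a)) \<longlonglongrightarrow> 0"
      using assms(2) by real_asymp
  qed
  have eq: "eventually (\<lambda>n. H (-1 * real n) + \<i> * integral {- real n..real n} (\<lambda>t. f (Complex b t))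
               - H (1 * real n) - \<i> * integral {- real n..real n} (\<lambda>t. f (Complex a t)) =
               2 * of_real pi * \<i> * S) sequentially"
  proof -
    have "eventually (\<lambda>n. real n \<ge> max 1 (T1 + 1)) sequentially"
      using filterlim_real_sequentially unfolding filterlim_at_top by blast
    thus ?thesis
    proof eventually_elim
      case (elim n)
      define t where "t = real n"
      have t: "t \<ge> 1" "t \<ge> T1 + 1" using elim by (auto simp: t_def)
      let ?a1 = "Complex a (-t)" and ?a3 = "Complex b t"
      let ?a2 = "Complex b (-t)" and ?a4 = "Complex a t"
      let ?R = "rectpath ?a1 ?a3"
      have img: "path_image ?R \<subseteq> U - pts"
        using t T1 pts(2) U(3) assms(1) by (subst path_image_rectpath) fastforce+
      have "contour_integral ?R f = 2 * pi * \<i> * (\<Sum>p\<in>pts. winding_number ?R p * residue f p)"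
      proof (rule Residue_theorem[OF U(1,2) pts(1) holo _ _ img])
        show "\<forall>z. z \<notin> U \<longrightarrow> winding_number ?R z = 0"
          using t assms(1) U(3) by (auto intro!: winding_number_rectpath_outside simp: in_cbox_complex_iff)
      qed auto
      \<comment> \<open>Because \<open>t \<ge> T1 + 1\<close>, the points strictly between the two
        lines are inside the rectangle, with winding number 1; all others are outside.\<close>
      also have "(\<Sum>p\<in>pts. winding_number ?R p * residue f p) = S"
        unfolding S_def
      proof (rule sum.mono_neutral_cong_right)
        show "\<forall>p\<in>pts - {p \<in> pts. a < Re p \<and> Re p < b}. winding_number ?R p * residue f p = 0"
          using t assms(1)
          by (auto intro!: winding_number_rectpath_outside simp: in_cbox_complex_iff dest: pts(2))
        show "winding_number ?R p * residue f p = residue f p"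
          if "p \<in> {p \<in> pts. a < Re p \<and> Re p < b}" for p
        proof -
          have "p \<in> box ?a1 ?a3" using that T1[of p] t by (auto simp: in_box_complex_iff)
          thus ?thesis by (simp add: winding_number_rectpath)
        qed
      qed (use pts in auto)
      finally have 1: "contour_integral ?R f = 2 * of_real pi * \<i> * S" by simp
      have ci: "f contour_integrable_on linepath x y" if "closed_segment x y \<subseteq> path_image ?R" for x y
        using that img by (intro contour_integrable_continuous_linepath continuous_on_subset[OF cont]) blast
      have pim: "closed_segment ?a1 ?a2 \<subseteq> path_image ?R" "closed_segment ?a2 ?a3 \<subseteq> path_image ?R"
        "closed_segment ?a3 ?a4 \<subseteq> path_image ?R" "closed_segment ?a4 ?a1 \<subseteq> path_image ?R"
        by (auto simp: rectpath_def Let_def path_image_join)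
      have "contour_integral ?R f = contour_integral (linepath ?a1 ?a2) f +
        (contour_integral (linepath ?a2 ?a3) f + (contour_integral (linepath ?a3 ?a4) f +
         contour_integral (linepath ?a4 ?a1) f))"
        unfolding rectpath_def Let_def using ci[OF pim(1)] ci[OF pim(2)] ci[OF pim(3)] ci[OF pim(4)]
        by (simp add: contour_integrable_joinI)
      also have "contour_integral (linepath ?a3 ?a4) f = - contour_integral (linepath ?a4 ?a3) f"
        by (subst contour_integral_reverse_linepath[symmetric])
           (use ci pim in \<open>auto intro!: continuous_on_subset[OF cont] simp: closed_segment_commute dest: subsetD[OF img] subsetD[OF pim(3)]\<close>)
      also have "contour_integral (linepath ?a4 ?a1) f = - contour_integral (linepath ?a1 ?a4) f"
        by (subst contour_integral_reverse_linepath[symmetric])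
           (use ci pim in \<open>auto intro!: continuous_on_subset[OF cont] simp: closed_segment_commute dest: subsetD[OF img] subsetD[OF pim(4)]\<close>)
      also have "contour_integral (linepath ?a1 ?a4) f = \<i> * integral {- t..t} (\<lambda>t. f (Complex a t))"
        using t by (intro contour_integral_linepath_same_Re) auto
      also have "contour_integral (linepath ?a2 ?a3) f = \<i> * integral {- t..t} (\<lambda>t. f (Complex b t))"
        using t by (intro contour_integral_linepath_same_Re) auto
      finally show ?case using 1 by (simp add: H_def t_def algebra_simps)
    qed
  qed
  have "(\<lambda>n. H (-1 * real n) + \<i> * integral {- real n..real n} (\<lambda>t. f (Complex b t))
               - H (1 * real n) - \<i> * integral {- real n..real n} (\<lambda>t. f (Complex a t))) \<longlonglongrightarrow>
         0 + \<i> * (LINT t|lborel. f (Complex b t)) - 0 - \<i> * (LINT t|lborel. f (Complex a t))"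
    by (intro tendsto_intros H_lim integral_Icc_symmetric_tendsto int) auto
  moreover have "(\<lambda>n. H (-1 * real n) + \<i> * integral {- real n..real n} (\<lambda>t. f (Complex b t))
               - H (1 * real n) - \<i> * integral {- real n..real n} (\<lambda>t. f (Complex a t))) \<longlonglongrightarrow>
         2 * of_real pi * \<i> * S"
    by (rule tendsto_eventually[OF eq])
  ultimately have "\<i> * ((LINT t|lborel. f (Complex b t)) - (LINT t|lborel. f (Complex a t))) =
                   \<i> * (2 * of_real pi * S)"
    using LIMSEQ_unique by (fastforce simp: algebra_simps)
  thus ?thesis unfolding S_def by (subst (asm) mult_left_cancel) auto
qed

text \<open>Ratio test: consecutive terms differ by \<open>E / ((a + n) (b + n))\<close>, of modulus
  at most 1/2 for large \<open>n\<close>. If a Pochhammer symbol vanishes, the terms are 0 from then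
  on by \<open>x / 0 = 0\<close>. The lemma serves both the Bessel series and the decay of the
  shifted integrals.\<close>

lemma summable_power_div_pochhammer:
  fixes a b E :: "'a :: {real_normed_field, banach}"
  shows "summable (\<lambda>n. E ^ n / (pochhammer a n * pochhammer b n))"
proof -
  obtain N :: nat where N: "norm a + norm b + 2 * norm E + 1 \<le> real N"
    using real_arch_simple by blast
  show ?thesis
  proof (rule summable_ratio_test[of "1/2" N])
    fix n assume n: "n \<ge> N"
    have "1 \<le> norm (a + of_nat n)"
      using norm_diff_ineq[of "of_nat n" a] n N norm_ge_zero[of a] norm_ge_zero[of b] norm_ge_zero[of E]
      by (simp add: add.commute del: norm_ge_zero)
    moreover have "2 * norm E \<le> norm (b + of_nat n)"
      using norm_diff_ineq[of "of_nat n" b] n N norm_ge_zero[of a]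
      by (simp add: add.commute del: norm_ge_zero)
    ultimately have "1 * (2 * norm E) \<le> norm (a + of_nat n) * norm (b + of_nat n)"
      by (intro mult_mono) auto
    moreover have "0 < norm (a + of_nat n) * norm (b + of_nat n)"
      using norm_diff_ineq[of "of_nat n" b] norm_diff_ineq[of "of_nat n" a] n N norm_ge_zero[of a] norm_ge_zero[of b] norm_ge_zero[of E]
      by (intro mult_pos_pos) (auto simp: add.commute simp del: norm_ge_zero zero_less_norm_iff)
    ultimately have "norm E / (norm (a + of_nat n) * norm (b + of_nat n)) \<le> 1 / 2"
      by (simp add: field_simps)
    hence "norm E / (norm (a + of_nat n) * norm (b + of_nat n)) * norm (E ^ n / (pochhammer a n * pochhammer b n))
           \<le> 1 / 2 * norm (E ^ n / (pochhammer a n * pochhammer b n))"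
      by (rule mult_right_mono) auto
    thus "norm (E ^ Suc n / (pochhammer a (Suc n) * pochhammer b (Suc n))) \<le>
          1 / 2 * norm (E ^ n / (pochhammer a n * pochhammer b n))"
      by (simp add: pochhammer_rec' norm_divide norm_mult mult_ac)
  qed simp
qed

section \<open>The Mellin--Barnes integral of the Bessel function\<close>

text \<open>For \<open>L = ln y \<plusminus> i\<pi>/2\<close> the exponential is
  \<open>y^(-s)\<close> times one exponential of the cosine. Using the logarithm \<open>L\<close> as
  parameter makes this factor entire in \<open>s\<close> and free of branch choices.\<close>

definition mb_kernel :: "complex \<Rightarrow> complex \<Rightarrow> complex \<Rightarrow> complex" where
  "mb_kernel L \<nu> s = Gamma s * Gamma (s - \<nu>) * exp (- (L * s))"

lemma norm_exp_mult_le: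
  assumes "\<bar>Im L\<bar> \<le> pi / 2" "\<bar>Re s\<bar> \<le> M"
  shows "norm (exp (- (L * s))) \<le> exp (\<bar>Re L\<bar> * M) * exp (pi / 2 * \<bar>Im s\<bar>)"
proof -
  have "- (Re L * Re s) \<le> \<bar>Re L\<bar> * M"
    using mult_mono[of "\<bar>Re L\<bar>" "\<bar>Re L\<bar>" "\<bar>Re s\<bar>" M] assms
    by (simp add: abs_mult[symmetric])
  moreover have "Im L * Im s \<le> pi / 2 * \<bar>Im s\<bar>"
    using mult_mono[of "\<bar>Im L\<bar>" "pi / 2" "\<bar>Im s\<bar>" "\<bar>Im s\<bar>"] assms
    by (simp add: abs_mult[symmetric])
  ultimately show ?thesis by (simp flip: exp_add)
qed

text \<open>
  The rate \<open>3\<pi>/8\<close> for each Gamma factor is one choice in \<open>(\<pi>/4, \<pi>/2)\<close>; it outweighs the growth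
  \<open>e^(\<pi>|t|/2)\<close> of the exponential factor.
\<close>

lemma mb_kernel_bound:
  assumes "norm (Gamma s) \<le> C1 * exp (- (3 * pi / 8 * \<bar>Im s\<bar>))"
    and "norm (Gamma (s - \<nu>)) \<le> C2 * exp (- (3 * pi / 8 * \<bar>Im (s - \<nu>)\<bar>))"
    and "\<bar>Im L\<bar> \<le> pi / 2" "\<bar>Re s\<bar> \<le> M" "\<bar>Im \<nu>\<bar> \<le> R" "C1 > 0" "C2 > 0"
  shows "norm (mb_kernel L \<nu> s) \<le>
           C1 * C2 * exp (3 * pi / 8 * R) * exp (\<bar>Re L\<bar> * M) * exp (- (pi / 4 * \<bar>Im s\<bar>))"
proof -
  have "\<bar>Im s\<bar> - R \<le> \<bar>Im (s - \<nu>)\<bar>" using assms by simp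
  hence "3 * pi / 8 * (\<bar>Im s\<bar> - R) \<le> 3 * pi / 8 * \<bar>Im (s - \<nu>)\<bar>" by (intro mult_left_mono) auto
  hence "exp (- (3 * pi / 8 * \<bar>Im (s - \<nu>)\<bar>)) \<le> exp (3 * pi / 8 * R) * exp (- (3 * pi / 8 * \<bar>Im s\<bar>))"
    by (simp add: algebra_simps flip: exp_add)
  hence 2: "norm (Gamma (s - \<nu>)) \<le> C2 * (exp (3 * pi / 8 * R) * exp (- (3 * pi / 8 * \<bar>Im s\<bar>)))"
    using assms by (meson less_imp_le mult_left_mono order_trans)
  have "norm (mb_kernel L \<nu> s) \<le> (C1 * exp (- (3 * pi / 8 * \<bar>Im s\<bar>))) *
      (C2 * (exp (3 * pi / 8 * R) * exp (- (3 * pi / 8 * \<bar>Im s\<bar>)))) *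
      (exp (\<bar>Re L\<bar> * M) * exp (pi / 2 * \<bar>Im s\<bar>))"
    unfolding mb_kernel_def norm_mult using assms
    by (intro mult_mono 2 norm_exp_mult_le) auto
  also have "\<dots> = C1 * C2 * exp (3 * pi / 8 * R) * exp (\<bar>Re L\<bar> * M) *
      (exp (- (3 * pi / 8 * \<bar>Im s\<bar>)) * exp (- (3 * pi / 8 * \<bar>Im s\<bar>)) * exp (pi / 2 * \<bar>Im s\<bar>))"
    by (simp only: mult_ac)
  also have "exp (- (3 * pi / 8 * \<bar>Im s\<bar>)) * exp (- (3 * pi / 8 * \<bar>Im s\<bar>)) * exp (pi / 2 * \<bar>Im s\<bar>) =
             exp (- (pi / 4 * \<bar>Im s\<bar>))"
    by (simp add: algebra_simps flip: exp_add)
  finally show ?thesis .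
qed

lemma mb_kernel_decay:
  assumes "\<bar>Im L\<bar> \<le> pi / 2"
  shows "\<exists>C T. \<forall>s. a \<le> Re s \<and> Re s \<le> b \<and> \<bar>Im s\<bar> \<ge> T \<longrightarrow>
           norm (mb_kernel L \<nu> s) \<le> C * exp (- (pi / 4 * \<bar>Im s\<bar>))"
proof -
  obtain C1 where C1: "C1 > 0" "\<And>s. a \<le> Re s \<and> Re s \<le> b \<and> \<bar>Im s\<bar> \<ge> 1 \<Longrightarrow>
      norm (Gamma s) \<le> C1 * exp (- (3 * pi / 8 * \<bar>Im s\<bar>))"
    using Gamma_vertical_decay_strip[of "3 * pi / 8" a b] by auto
  obtain C2 where C2: "C2 > 0" "\<And>s. a - Re \<nu> \<le> Re s \<and> Re s \<le> b - Re \<nu> \<and> \<bar>Im s\<bar> \<ge> 1 \<Longrightarrow>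
      norm (Gamma s) \<le> C2 * exp (- (3 * pi / 8 * \<bar>Im s\<bar>))"
    using Gamma_vertical_decay_strip[of "3 * pi / 8" "a - Re \<nu>" "b - Re \<nu>"] by auto
  \<comment> \<open>The threshold \<open>1 + |Im \<nu>|\<close> makes both \<open>|Im s|\<close> and
    \<open>|Im (s - \<nu>)|\<close> at least 1, as the strip bound for \<open>\<Gamma>\<close>
    requires.\<close>
  show ?thesis
    using C1(1) C2(1) assms
    by (intro exI[of _ "1 + \<bar>Im \<nu>\<bar>"] allI impI mb_kernel_bound C1(2) C2(2)
          exI[of _ "C1 * C2 * exp (3 * pi / 8 * \<bar>Im \<nu>\<bar>) * exp (\<bar>Re L\<bar> * max \<bar>a\<bar> \<bar>b\<bar>)"])
       auto
qed

text \<open>One constant serves a whole bounded region of orders: this is the dominating function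
  for the limit in the order.\<close>

lemma mb_kernel_line_bound:
  assumes "\<bar>Im L\<bar> \<le> pi / 2" "c > 0" "a > 0"
  shows "\<exists>C. \<forall>\<nu> s. Re s = c \<and> a \<le> c - Re \<nu> \<and> c - Re \<nu> \<le> b \<and> \<bar>Im \<nu>\<bar> \<le> R \<longrightarrow>
           norm (mb_kernel L \<nu> s) \<le> C * exp (- (pi / 4 * \<bar>Im s\<bar>))"
proof -
  obtain C1 where C1: "C1 > 0" "\<And>s. c \<le> Re s \<and> Re s \<le> c \<Longrightarrow>
      norm (Gamma s) \<le> C1 * exp (- (3 * pi / 8 * \<bar>Im s\<bar>))"
    using Gamma_vertical_decay[of c "3 * pi / 8" c] assms by auto
  obtain C2 where C2: "C2 > 0" "\<And>s. a \<le> Re s \<and> Re s \<le> b \<Longrightarrow>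
      norm (Gamma s) \<le> C2 * exp (- (3 * pi / 8 * \<bar>Im s\<bar>))"
    using Gamma_vertical_decay[of a "3 * pi / 8" b] assms by auto
  show ?thesis
    using C1(1) C2(1) assms
    by (intro exI[of _ "C1 * C2 * exp (3 * pi / 8 * R) * exp (\<bar>Re L\<bar> * c)"] allI impI
          mb_kernel_bound C1(2) C2(2)) auto
qed

lemma Complex_in_nonpos_Ints_imp: "Complex x y \<in> \<int>\<^sub>\<le>\<^sub>0 \<Longrightarrow> x \<in> \<int>\<^sub>\<le>\<^sub>0"
  by (auto elim!: nonpos_Ints_cases simp: complex_eq_iff nonpos_Ints_of_int)

lemma continuous_mb_kernel_line:
  assumes "c \<notin> \<int>\<^sub>\<le>\<^sub>0" "c - Re \<nu> \<notin> \<int>\<^sub>\<le>\<^sub>0"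
  shows "continuous_on UNIV (\<lambda>t. mb_kernel L \<nu> (Complex c t))"
proof -
  have "Complex c t - \<nu> = Complex (c - Re \<nu>) (t - Im \<nu>)" for t
    by (simp add: complex_eq_iff)
  hence "Complex c t \<notin> \<int>\<^sub>\<le>\<^sub>0" "Complex c t - \<nu> \<notin> \<int>\<^sub>\<le>\<^sub>0" for t
    using assms Complex_in_nonpos_Ints_imp by metis+
  moreover have "isCont (Complex c) t" for t
    unfolding Complex_eq[abs_def] by (intro continuous_intros)
  ultimately show ?thesis
    unfolding mb_kernel_def by (intro continuous_at_imp_continuous_on ballI continuous_intros) auto
qed

lemma integrable_mb_kernel_line:
  assumes "\<bar>Im L\<bar> \<le> pi / 2" "c \<notin> \<int>\<^sub>\<le>\<^sub>0" "c - Re \<nu> \<notin> \<int>\<^sub>\<le>\<^sub>0"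
  shows "integrable lborel (\<lambda>t. mb_kernel L \<nu> (Complex c t))"
proof -
  obtain C T where CT: "\<And>s. c \<le> Re s \<and> Re s \<le> c \<and> \<bar>Im s\<bar> \<ge> T \<Longrightarrow>
           norm (mb_kernel L \<nu> s) \<le> C * exp (- (pi / 4 * \<bar>Im s\<bar>))"
    using mb_kernel_decay[OF assms(1), of c c \<nu>] by blast
  show ?thesis
    using CT by (intro integrable_exp_decay[of "pi / 4" _ T C] continuous_mb_kernel_line assms)
                (auto dest!: meta_spec[of _ "Complex c _"])
qed

section \<open>Residues at the two families of poles\<close>

text \<open>For non-integral order, \<open>-k\<close> is a simple pole of \<open>Gamma s\<close> and
  a regular point of \<open>Gamma (s - \<nu>)\<close>, so the residue of \<open>\<Gamma>\<close> is
  multiplied by the value of the other factors.\<close>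

lemma residue_mb_kernel_minus_nat:
  assumes "\<nu> \<notin> \<int>"
  shows "residue (mb_kernel L \<nu>) (- of_nat k) =
           (-1) ^ k / fact k * (Gamma (- of_nat k - \<nu>) * exp (L * of_nat k))"
proof (rule residue_simple')
  let ?p = "- of_nat k :: complex"
  \<comment> \<open>This open set omits every pole of the two Gamma factors except
    \<open>?p\<close>.\<close>
  let ?S = "- (\<int>\<^sub>\<le>\<^sub>0 - {?p}) \<inter> (\<lambda>s. s - \<nu>) -` (- \<int>\<^sub>\<le>\<^sub>0)"
  have *: "?p - \<nu> \<notin> \<int>\<^sub>\<le>\<^sub>0"
  proof
    assume "?p - \<nu> \<in> \<int>\<^sub>\<le>\<^sub>0"
    hence "?p - (?p - \<nu>) \<in> \<int>" using nonpos_Ints_subset_Ints by (intro Ints_diff) auto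
    thus False using assms by simp
  qed
  show "open ?S"
    by (intro open_Int open_Compl closed_subset_Ints open_vimage continuous_intros) auto
  show "?p \<in> ?S" using * by auto
  show "mb_kernel L \<nu> holomorphic_on ?S - {?p}"
    unfolding mb_kernel_def[abs_def] by (intro holomorphic_intros) auto
  have "isCont (\<lambda>w. Gamma (w - \<nu>) * exp (- (L * w))) ?p"
    using * by (intro continuous_intros) auto
  hence "(\<lambda>w. Gamma w * (w + of_nat k) * (Gamma (w - \<nu>) * exp (- (L * w)))) \<midarrow>?p\<rightarrow>
          (-1) ^ k / fact k * (Gamma (?p - \<nu>) * exp (- (L * ?p)))"
    unfolding isCont_def by (rule tendsto_mult[OF Gamma_residues])
  thus "(\<lambda>w. mb_kernel L \<nu> w * (w - ?p)) \<midarrow>?p\<rightarrow> (-1) ^ k / fact k * (Gamma (?p - \<nu>) * exp (L * of_nat k))"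
    by (simp add: mb_kernel_def mult_ac)
qed

text \<open>Here the pole comes from \<open>Gamma (s - \<nu>)\<close>. Splitting off
  \<open>exp (- (L * \<nu>))\<close> leaves the residue at \<open>-k\<close> with
  \<open>-\<nu>\<close> for \<open>\<nu>\<close>, so one reflection lemma treats both
  families.\<close>

lemma residue_mb_kernel_order_minus_nat:
  assumes "\<nu> \<notin> \<int>"
  shows "residue (mb_kernel L \<nu>) (\<nu> - of_nat k) =
           exp (- (L * \<nu>)) * ((-1) ^ k / fact k * (Gamma (- of_nat k + \<nu>) * exp (L * of_nat k)))"
proof (rule residue_simple')
  let ?q = "- of_nat k :: complex"
  let ?p = "\<nu> - of_nat k :: complex"
  let ?S = "- \<int>\<^sub>\<le>\<^sub>0 \<inter> (\<lambda>s. s - \<nu>) -` (- (\<int>\<^sub>\<le>\<^sub>0 - {?q}))"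
  have *: "?p \<notin> \<int>\<^sub>\<le>\<^sub>0"
  proof
    assume "?p \<in> \<int>\<^sub>\<le>\<^sub>0"
    hence "?p + of_nat k \<in> \<int>" using nonpos_Ints_subset_Ints by (intro Ints_add) auto
    thus False using assms by simp
  qed
  show "open ?S"
    by (intro open_Int open_Compl closed_subset_Ints open_vimage continuous_intros) auto
  show "?p \<in> ?S" using * by auto
  show "mb_kernel L \<nu> holomorphic_on ?S - {?p}"
    unfolding mb_kernel_def[abs_def] by (intro holomorphic_intros) (auto simp: algebra_simps)
  have "(\<lambda>w. Gamma (w + - \<nu>) * ((w + - \<nu>) + of_nat k)) \<midarrow>(?q - (- \<nu>))\<rightarrow> (-1) ^ k / fact k"
    by (intro LIM_offset Gamma_residues)
  hence "(\<lambda>w. Gamma (w - \<nu>) * ((w - \<nu>) + of_nat k)) \<midarrow>?p\<rightarrow> (-1) ^ k / fact k" by simp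
  moreover have "isCont (\<lambda>w. Gamma w * exp (- (L * w))) ?p"
    using * by (intro continuous_intros) auto
  ultimately have "(\<lambda>w. Gamma (w - \<nu>) * ((w - \<nu>) + of_nat k) * (Gamma w * exp (- (L * w)))) \<midarrow>?p\<rightarrow>
          (-1) ^ k / fact k * (Gamma ?p * exp (- (L * ?p)))"
    unfolding isCont_def by (rule tendsto_mult)
  moreover have "exp (- (L * ?p)) = exp (- (L * \<nu>)) * exp (L * of_nat k)"
    by (simp add: algebra_simps flip: exp_add)
  ultimately show "(\<lambda>w. mb_kernel L \<nu> w * (w - ?p)) \<midarrow>?p\<rightarrow>
      exp (- (L * \<nu>)) * ((-1) ^ k / fact k * (Gamma (?q + \<nu>) * exp (L * of_nat k)))"
    by (simp add: mb_kernel_def algebra_simps)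
qed

text \<open>Reflection at \<open>-k - \<nu>\<close> produces
  \<open>sin (\<pi>(-k - \<nu>)) = -(-1)^k sin (\<pi>\<nu>)\<close>, whose sign cancels the
  \<open>(-1)^k\<close> of the residue. The result is a term of the Bessel series.\<close>

lemma Gamma_neg_reflection:
  fixes \<nu> L :: complex
  assumes "\<nu> \<notin> \<int>"
  shows "(-1) ^ k / fact k * (Gamma (- of_nat k - \<nu>) * exp (L * of_nat k)) =
     - (of_real pi / sin (of_real pi * \<nu>)) * (exp L ^ k * rGamma (\<nu> + of_nat k + 1) / fact k)"
proof -
  let ?z = "- of_nat k - \<nu> :: complex"
  have "1 - ?z \<notin> \<int>"
  proof
    assume "1 - ?z \<in> \<int>"
    hence "1 - ?z - 1 - of_nat k \<in> \<int>" by (intro Ints_diff) auto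
    thus False using assms by simp
  qed
  hence "1 - ?z \<notin> \<int>\<^sub>\<le>\<^sub>0" using nonpos_Ints_subset_Ints by blast
  hence "Gamma ?z = Gamma ?z * Gamma (1 - ?z) * rGamma (1 - ?z)"
    by (simp only: rGamma_inverse_Gamma) (simp add: Gamma_eq_zero_iff)
  also have "Gamma ?z * Gamma (1 - ?z) = of_real pi / sin (of_real pi * ?z)"
    by (rule Gamma_reflection_complex)
  also have "sin (of_real pi * ?z) = - sin (of_real (real k * pi) + of_real pi * \<nu>)"
    by (simp flip: sin_minus) (simp add: algebra_simps)
  also have "\<dots> = - ((-1) ^ k * sin (of_real pi * \<nu>))"
    by (simp only: sin_add sin_of_real cos_of_real sin_npi cos_npi) simp
  finally have "Gamma ?z = of_real pi / (- ((-1) ^ k * sin (of_real pi * \<nu>))) * rGamma (\<nu> + of_nat k + 1)"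
    by (simp add: algebra_simps)
  moreover have "(-1) ^ k * (-1) ^ k = (1 :: complex)" by (simp flip: power_mult_distrib)
  ultimately show ?thesis
    by (simp add: exp_of_nat_mult[symmetric] mult_ac)
qed

section \<open>Bessel functions at the argument \<open>2 e^(L/2)\<close>\<close>

text \<open>For \<open>w = 2 e^(L/2)\<close> one has \<open>w^2 / 4 = e^L\<close>, so these are the
  terms of the series in \<open>bessel_I\<close>.\<close>

definition bessel_coeff :: "complex \<Rightarrow> complex \<Rightarrow> nat \<Rightarrow> complex" where
  "bessel_coeff L \<nu> k = exp L ^ k * rGamma (\<nu> + of_nat k + 1) / fact k"

lemma summable_bessel_coeff:
  assumes "\<nu> \<notin> \<int>"
  shows "summable (bessel_coeff L \<nu>)"
proof -
  have z: "\<nu> + 1 \<notin> \<int>\<^sub>\<le>\<^sub>0"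
  proof
    assume "\<nu> + 1 \<in> \<int>\<^sub>\<le>\<^sub>0"
    hence "\<nu> + 1 - 1 \<in> \<int>" using nonpos_Ints_subset_Ints by (intro Ints_diff) auto
    thus False using assms by simp
  qed
  have "bessel_coeff L \<nu> k = rGamma (\<nu> + 1) * (exp L ^ k / (pochhammer (\<nu> + 1) k * pochhammer 1 k))" for k
  proof -
    have "pochhammer (\<nu> + 1) k \<noteq> 0"
      using z by (auto simp: pochhammer_eq_0_iff)
    thus ?thesis
      using pochhammer_rGamma[of "\<nu> + 1" k] by (simp add: bessel_coeff_def pochhammer_fact add_ac)
  qed
  hence "bessel_coeff L \<nu> = (\<lambda>k. rGamma (\<nu> + 1) * (exp L ^ k / (pochhammer (\<nu> + 1) k * pochhammer 1 k)))"
    by (rule ext)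
  thus ?thesis by (simp only: summable_mult summable_power_div_pochhammer)
qed

text \<open>The bound on \<open>Im L\<close> keeps \<open>L/2\<close> in the principal strip, so
  \<open>Ln\<close> undoes \<open>exp\<close> and the power becomes
  \<open>exp (L * \<nu> / 2)\<close>.\<close>

lemma bessel_I_exp:
  assumes "\<bar>Im L\<bar> \<le> pi / 2"
  shows "bessel_I \<nu> (2 * exp (L / 2)) = exp (L * \<nu> / 2) * (\<Sum>k. bessel_coeff L \<nu> k)"
proof -
  have "- pi < Im L / 2" "Im L / 2 \<le> pi" using assms pi_gt_zero by linarith+
  hence "Ln (exp (L / 2)) = L / 2" by (intro Ln_exp) simp_all
  hence "exp (L / 2) powr \<nu> = exp (\<nu> * (L / 2))"
    by (simp only: powr_def exp_not_eq_zero if_False)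
  moreover have "(2 * exp (L / 2))\<^sup>2 / 4 = exp L"
    by (simp add: power_mult_distrib flip: exp_double)
  ultimately show ?thesis by (simp add: bessel_I_def bessel_coeff_def mult.commute)
qed

text \<open>The prefactor cancels the exponential of \<open>I_\<nu>\<close> and turns that of
  \<open>I_(-\<nu>)\<close> into \<open>exp (- (L * \<nu>))\<close>: these are the weights of the
  two residue families.\<close>

lemma bessel_K_exp_nonint:
  assumes "\<bar>Im L\<bar> \<le> pi / 2" "\<nu> \<notin> \<int>"
  shows "exp (- (L * \<nu> / 2)) * bessel_K \<nu> (2 * exp (L / 2)) =
    1 / 2 * (- (of_real pi / sin (of_real pi * \<nu>)) * (\<Sum>k. bessel_coeff L \<nu> k) +
      exp (- (L * \<nu>)) * (of_real pi / sin (of_real pi * \<nu>) * (\<Sum>k. bessel_coeff L (- \<nu>) k)))"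
proof -
  define X where "X = exp (L * \<nu> / 2)"
  have X: "exp (- (L * \<nu> / 2)) = inverse X" "exp (- (L * \<nu>)) = inverse X * inverse X" "X \<noteq> 0"
    by (auto simp: X_def exp_minus[symmetric] simp flip: exp_add)
  show ?thesis
    unfolding bessel_K_def Let_def using assms(2) X
    by (simp add: bessel_I_exp[OF assms(1)] X_def[symmetric] algebra_simps diff_divide_distrib)
qed

section \<open>Moving the line of integration to minus infinity\<close>

text \<open>The index set describes the poles \<open>-k\<close> to the right of abscissa
  \<open>d - N\<close>. It is an initial segment whose length tends to infinity.\<close>

lemma sum_upto_real_tendsto_suminf:
  fixes f :: "nat \<Rightarrow> complex"
  assumes "summable f"
  shows "(\<lambda>N. \<Sum>k | real k < real N - d. f k) \<longlonglongrightarrow> (\<Sum>k. f k)"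
proof -
  have "{k. real k < real N - d} = {..<nat \<lceil>real N - d\<rceil>}" for N
    by (auto simp: less_ceiling_iff zless_nat_eq_int_zless)
  moreover have "filterlim (\<lambda>N. nat \<lceil>real N - d\<rceil>) at_top sequentially"
    by real_asymp
  ultimately show ?thesis
    using filterlim_compose[OF summable_LIMSEQ[OF assms]] by simp
qed

lemma norm_pochhammer_ge:
  "\<bar>pochhammer (Re s) n\<bar> \<le> norm (pochhammer s n)"
proof -
  have "\<bar>pochhammer (Re s) n\<bar> = (\<Prod>i<n. \<bar>Re s + real i\<bar>)"
    by (simp add: pochhammer_prod abs_prod atLeast0LessThan)
  also have "\<dots> \<le> (\<Prod>i<n. norm (s + of_nat i))"
  proof (intro prod_mono conjI)
    show "\<bar>Re s + real i\<bar> \<le> norm (s + of_nat i)" for i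
      using abs_Re_le_cmod[of "s + of_nat i"] by simp
  qed auto
  also have "\<dots> = norm (pochhammer s n)"
    by (simp add: pochhammer_prod prod_norm atLeast0LessThan)
  finally show ?thesis .
qed

text \<open>In \<open>\<Gamma>(s) = (s - N)_N \<Gamma>(s - N)\<close> each Pochhammer factor is at
  least its real part in modulus; reversing their order gives \<open>(1 - Re s)_N\<close> up to
  sign. The gain does not depend on \<open>Im s\<close>.\<close>

lemma norm_Gamma_minus_nat_le:
  assumes "Re s \<notin> \<int>"
  shows "norm (Gamma (s - of_nat N)) \<le> norm (Gamma s) / \<bar>pochhammer (1 - Re s) N\<bar>"
proof -
  have nz: "pochhammer (1 - Re s) N \<noteq> 0"
  proof
    assume "pochhammer (1 - Re s) N = 0"
    then obtain k where "1 - Re s = - real k" by (auto simp: pochhammer_eq_0_iff)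
    hence "Re s = of_int (int k + 1)" by simp
    thus False using assms by (metis Ints_of_int)
  qed
  have "s - of_nat N \<notin> \<int>\<^sub>\<le>\<^sub>0"
  proof
    assume "s - of_nat N \<in> \<int>\<^sub>\<le>\<^sub>0"
    then obtain k where "s - of_nat N = - of_nat k" by (auto elim!: nonpos_Ints_cases')
    hence "Re s = of_int (int N - int k)" by (simp add: complex_eq_iff)
    thus False using assms by (metis Ints_of_int)
  qed
  hence "Gamma s = pochhammer (s - of_nat N) N * Gamma (s - of_nat N)"
    using pochhammer_Gamma[of "s - of_nat N" N] by (simp add: Gamma_eq_zero_iff)
  hence "norm (Gamma s) = norm (pochhammer (s - of_nat N) N) * norm (Gamma (s - of_nat N))"
    by (simp add: norm_mult)
  moreover have "\<bar>pochhammer (1 - Re s) N\<bar> \<le> norm (pochhammer (s - of_nat N) N)"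
    using norm_pochhammer_ge[of "s - of_nat N" N] pochhammer_minus[of "Re s - 1" N]
    by (simp add: abs_mult power_abs)
  ultimately have "norm (Gamma (s - of_nat N)) * \<bar>pochhammer (1 - Re s) N\<bar> \<le> norm (Gamma s)"
    by (simp add: mult.commute mult_left_mono)
  thus ?thesis using nz by (simp add: field_simps)
qed

text \<open>Shifting by \<open>N\<close> multiplies the modulus of the integrand by at most
  \<open>|q N|\<close>, uniformly in \<open>t\<close>, and \<open>q N\<close> is the general term of
  a convergent series.\<close>

lemma mb_kernel_line_left_tendsto_0:
  assumes "\<bar>Im L\<bar> \<le> pi / 2" "d \<notin> \<int>" "d - Re \<nu> \<notin> \<int>"
  shows "(\<lambda>N. LINT t|lborel. mb_kernel L \<nu> (Complex (d - real N) t)) \<longlonglongrightarrow> 0"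
proof (rule Lim_null_comparison)
  define I where "I = (LINT t|lborel. norm (mb_kernel L \<nu> (Complex d t)))"
  define q where "q = (\<lambda>N. exp (Re L) ^ N / (pochhammer (1 - d) N * pochhammer (1 - (d - Re \<nu>)) N))"
  have "d \<notin> \<int>\<^sub>\<le>\<^sub>0" "d - Re \<nu> \<notin> \<int>\<^sub>\<le>\<^sub>0"
    using assms nonpos_Ints_subset_Ints by auto
  note int = integrable_mb_kernel_line[OF assms(1) this]
  have "q \<longlonglongrightarrow> 0"
    unfolding q_def by (intro summable_LIMSEQ_zero summable_power_div_pochhammer)
  thus "(\<lambda>N. \<bar>q N\<bar> * I) \<longlonglongrightarrow> 0"
    by (intro tendsto_mult_left_zero tendsto_rabs_zero)
  have "norm (LINT t|lborel. mb_kernel L \<nu> (Complex (d - real N) t)) \<le> \<bar>q N\<bar> * I" for N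
  proof -
    have "norm (LINT t|lborel. mb_kernel L \<nu> (Complex (d - real N) t)) \<le>
          (LINT t|lborel. norm (mb_kernel L \<nu> (Complex (d - real N) t)))"
      by (rule integral_norm_bound)
    also have "\<dots> \<le> (LINT t|lborel. \<bar>q N\<bar> * norm (mb_kernel L \<nu> (Complex d t)))"
    proof (rule integral_mono')
      show "integrable lborel (\<lambda>t. \<bar>q N\<bar> * norm (mb_kernel L \<nu> (Complex d t)))"
        using int by auto
      fix t
      let ?s = "Complex d t"
      have s: "Complex (d - real N) t = ?s - of_nat N" by (simp add: complex_eq_iff)
      have e: "norm (exp (- (L * (?s - of_nat N)))) = exp (Re L) ^ N * norm (exp (- (L * ?s)))"
        by (simp add: algebra_simps flip: exp_of_nat_mult exp_add)
      have "norm (mb_kernel L \<nu> (Complex (d - real N) t)) =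
            norm (Gamma (?s - of_nat N)) * norm (Gamma ((?s - \<nu>) - of_nat N)) * norm (exp (- (L * (?s - of_nat N))))"
        unfolding s by (simp add: mb_kernel_def norm_mult algebra_simps)
      also have "\<dots> \<le> (norm (Gamma ?s) / \<bar>pochhammer (1 - Re ?s) N\<bar>) *
            (norm (Gamma (?s - \<nu>)) / \<bar>pochhammer (1 - Re (?s - \<nu>)) N\<bar>) * (exp (Re L) ^ N * norm (exp (- (L * ?s))))"
        unfolding e using assms by (intro mult_mono norm_Gamma_minus_nat_le) auto
      also have "\<dots> = \<bar>q N\<bar> * norm (mb_kernel L \<nu> ?s)"
        by (simp add: q_def mb_kernel_def norm_mult abs_mult abs_divide)
      finally show "norm (mb_kernel L \<nu> (Complex (d - real N) t)) \<le> \<bar>q N\<bar> * norm (mb_kernel L \<nu> ?s)" .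
    qed auto
    finally show ?thesis by (simp add: I_def)
  qed
  thus "eventually (\<lambda>N. norm (LINT t|lborel. mb_kernel L \<nu> (Complex (d - real N) t)) \<le> \<bar>q N\<bar> * I) sequentially"
    by simp
qed

lemma mb_kernel_shift_finite:
  fixes c d :: real and \<nu> L :: complex and N :: nat
  assumes L: "\<bar>Im L\<bar> \<le> pi / 2" and \<nu>: "\<nu> \<notin> \<int>"
    and c: "d < c" "c > 0" "c > Re \<nu>" and d: "d \<notin> \<int>" "d - Re \<nu> \<notin> \<int>"
  shows "(LINT t|lborel. mb_kernel L \<nu> (Complex c t)) - (LINT t|lborel. mb_kernel L \<nu> (Complex (d - real N) t)) =
    2 * of_real pi *
     ((\<Sum>k | real k < real N - d. - (of_real pi / sin (of_real pi * \<nu>)) * bessel_coeff L \<nu> k) +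
      (\<Sum>k | real k < real N - (d - Re \<nu>).
         exp (- (L * \<nu>)) * (of_real pi / sin (of_real pi * \<nu>) * bessel_coeff L (- \<nu>) k)))"
proof -
  define a where "a = d - real N"
  \<comment> \<open>\<open>K\<close> exceeds the index of every pole in the half-plane
    \<open>Re s > a - 1\<close>, so finitely many points suffice there.\<close>
  obtain K :: nat where K: "\<bar>a\<bar> + \<bar>Re \<nu>\<bar> + 1 < real K" using reals_Archimedean2 by blast
  define p1 p2 :: "nat \<Rightarrow> complex" where "p1 = (\<lambda>k. - of_nat k)" and "p2 = (\<lambda>k. \<nu> - of_nat k)"
  define pts where "pts = p1 ` {..<K} \<union> p2 ` {..<K}"
  obtain C T where CT: "\<And>s. a \<le> Re s \<and> Re s \<le> c \<and> \<bar>Im s\<bar> \<ge> T \<Longrightarrow>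
      norm (mb_kernel L \<nu> s) \<le> C * exp (- (pi / 4 * \<bar>Im s\<bar>))"
    using mb_kernel_decay[OF L, of a c \<nu>] by blast
  have a1: "a \<noteq> - real k" for k
  proof
    assume "a = - real k"
    hence "d = of_int (int N - int k)" by (simp add: a_def)
    thus False using d(1) by (metis Ints_of_int)
  qed
  have a2: "a \<noteq> Re \<nu> - real k" for k
  proof
    assume "a = Re \<nu> - real k"
    hence "d - Re \<nu> = of_int (int N - int k)" by (simp add: a_def)
    thus False using d(2) by (metis Ints_of_int)
  qed
  \<comment> \<open>Non-integrality of \<open>\<nu>\<close> separates the two families, so the sum
    of residues splits.\<close>
  have ne: "p1 i \<noteq> p2 j" for i j
  proof
    assume "p1 i = p2 j"
    hence "\<nu> = of_int (int j - int i)" by (simp add: p1_def p2_def algebra_simps)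
    thus False using \<nu> by (metis Ints_of_int)
  qed
  have "(LINT t|lborel. mb_kernel L \<nu> (Complex c t)) - (LINT t|lborel. mb_kernel L \<nu> (Complex a t)) =
          2 * of_real pi * (\<Sum>p | p \<in> pts \<and> a < Re p \<and> Re p < c. residue (mb_kernel L \<nu>) p)"
  proof (rule vertical_line_shift[where U = "{s. Re s > a - 1}" and k = "pi / 4" and T = T and C = C])
    show "a < c" using c by (simp add: a_def)
    show "open {s. Re s > a - 1}" by (rule open_halfspace_Re_gt)
    show "connected {s. Re s > a - 1}" by (intro convex_connected convex_halfspace_Re_gt)
    show "finite pts" by (simp add: pts_def)
    show "Re p \<noteq> a \<and> Re p \<noteq> c" if "p \<in> pts" for p
      using that c a1 a2 by (fastforce simp: pts_def p1_def p2_def)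
    have notpole: "s \<notin> \<int>\<^sub>\<le>\<^sub>0" "s - \<nu> \<notin> \<int>\<^sub>\<le>\<^sub>0" if "s \<in> {s. Re s > a - 1} - pts" for s
    proof -
      show "s \<notin> \<int>\<^sub>\<le>\<^sub>0"
      proof
        assume "s \<in> \<int>\<^sub>\<le>\<^sub>0"
        then obtain k where k: "s = p1 k" by (auto elim!: nonpos_Ints_cases' simp: p1_def)
        hence "k < K" using that K by (auto simp: p1_def)
        thus False using that k by (auto simp: pts_def)
      qed
      show "s - \<nu> \<notin> \<int>\<^sub>\<le>\<^sub>0"
      proof
        assume "s - \<nu> \<in> \<int>\<^sub>\<le>\<^sub>0"
        then obtain k where k: "s = p2 k" by (auto elim!: nonpos_Ints_cases' simp: p2_def algebra_simps)
        hence "k < K" using that K by (auto simp: p2_def)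
        thus False using that k by (auto simp: pts_def)
      qed
    qed
    show "mb_kernel L \<nu> holomorphic_on {s. Re s > a - 1} - pts"
      unfolding mb_kernel_def[abs_def] using notpole by (intro holomorphic_intros) auto
  qed (use CT in auto)
  \<comment> \<open>All poles lie left of \<open>c\<close>, so only the condition
    \<open>Re p > d - N\<close> remains; it bounds the index in each family.\<close>
  also have "{p. p \<in> pts \<and> a < Re p \<and> Re p < c} =
             p1 ` {k. real k < real N - d} \<union> p2 ` {k. real k < real N - (d - Re \<nu>)}"
    using K c by (auto simp: pts_def p1_def p2_def a_def)
  also have "(\<Sum>p\<in>\<dots>. residue (mb_kernel L \<nu>) p) =
      (\<Sum>k | real k < real N - d. residue (mb_kernel L \<nu>) (p1 k)) +
      (\<Sum>k | real k < real N - (d - Re \<nu>). residue (mb_kernel L \<nu>) (p2 k))"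
  proof -
    have fin: "finite {k. real k < r}" for r
    proof -
      obtain m :: nat where "r \<le> real m" using real_arch_simple by blast
      hence "{k. real k < r} \<subseteq> {..<m}" by auto
      thus ?thesis by (rule finite_subset) simp
    qed
    have inj: "inj_on p1 A" "inj_on p2 A" for A by (auto simp: inj_on_def p1_def p2_def)
    show ?thesis using ne
      by (subst sum.union_disjoint) (auto intro!: finite_imageI fin simp: sum.reindex[OF inj(1)] sum.reindex[OF inj(2)])
  qed
  also have "(\<lambda>k. residue (mb_kernel L \<nu>) (p1 k)) =
               (\<lambda>k. - (of_real pi / sin (of_real pi * \<nu>)) * bessel_coeff L \<nu> k)"
    unfolding p1_def residue_mb_kernel_minus_nat[OF \<nu>] Gamma_neg_reflection[OF \<nu>] bessel_coeff_def ..
  also have "(\<lambda>k. residue (mb_kernel L \<nu>) (p2 k)) =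
      (\<lambda>k. exp (- (L * \<nu>)) * (of_real pi / sin (of_real pi * \<nu>) * bessel_coeff L (- \<nu>) k))"
    using Gamma_neg_reflection[of "- \<nu>" _ L] \<nu>
    unfolding p2_def residue_mb_kernel_order_minus_nat[OF \<nu>] bessel_coeff_def by simp
  finally show ?thesis by (simp only: a_def)
qed

lemma mb_integral_nonint:
  assumes L: "\<bar>Im L\<bar> \<le> pi / 2" and \<nu>: "\<nu> \<notin> \<int>" and c: "c > max 0 (Re \<nu>)"
  shows "(LINT t|lborel. mb_kernel L \<nu> (Complex c t)) =
           4 * of_real pi * (exp (- (L * \<nu> / 2)) * bessel_K \<nu> (2 * exp (L / 2)))"
proof -
  \<comment> \<open>Avoiding this countable set ensures that none of the lines
    \<open>Re s = d - N\<close> meets a pole.\<close>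
  have "countable (\<int> \<union> (\<lambda>x. x + Re \<nu>) ` \<int> :: real set)"
    by (intro countable_Un countable_image countable_int)
  then obtain d where "d \<in> {max 0 (Re \<nu>)<..<c}" and d': "d \<notin> \<int> \<union> (\<lambda>x. x + Re \<nu>) ` \<int>"
    using real_interval_avoid_countable_set[OF c] by blast
  hence d: "d < c" "d \<notin> \<int>" by auto
  have d2: "d - Re \<nu> \<notin> \<int>"
  proof
    assume "d - Re \<nu> \<in> \<int>"
    hence "(d - Re \<nu>) + Re \<nu> \<in> (\<lambda>x. x + Re \<nu>) ` \<int>" by (rule imageI)
    thus False using d' by simp
  qed
  let ?J = "\<lambda>N. LINT t|lborel. mb_kernel L \<nu> (Complex (d - real N) t)"
  let ?S = "\<lambda>N. 2 * of_real pi *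
     ((\<Sum>k | real k < real N - d. - (of_real pi / sin (of_real pi * \<nu>)) * bessel_coeff L \<nu> k) +
      (\<Sum>k | real k < real N - (d - Re \<nu>).
         exp (- (L * \<nu>)) * (of_real pi / sin (of_real pi * \<nu>) * bessel_coeff L (- \<nu>) k)))"
  have \<nu>': "- \<nu> \<notin> \<int>" using \<nu> by simp
  note summ = summable_bessel_coeff[OF \<nu>, of L] summable_bessel_coeff[OF \<nu>', of L]
  have "(\<lambda>N. ?J N + ?S N) \<longlonglongrightarrow> 0 + 2 * of_real pi *
     ((\<Sum>k. - (of_real pi / sin (of_real pi * \<nu>)) * bessel_coeff L \<nu> k) +
      (\<Sum>k. exp (- (L * \<nu>)) * (of_real pi / sin (of_real pi * \<nu>) * bessel_coeff L (- \<nu>) k)))"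
    using summ
    by (intro tendsto_add tendsto_mult tendsto_const mb_kernel_line_left_tendsto_0 L d d2
          sum_upto_real_tendsto_suminf summable_mult)
  \<comment> \<open>The shifted integral plus the residues collected so far is independent of
    \<open>N\<close>, hence equal to its limit.\<close>
  also have "(\<lambda>N. ?J N + ?S N) = (\<lambda>N. LINT t|lborel. mb_kernel L \<nu> (Complex c t))"
  proof
    fix N
    show "?J N + ?S N = (LINT t|lborel. mb_kernel L \<nu> (Complex c t))"
      using mb_kernel_shift_finite[OF L \<nu> d(1) _ _ d(2) d2, of N] c by (simp add: diff_eq_eq)
  qed
  finally have "(LINT t|lborel. mb_kernel L \<nu> (Complex c t)) = 2 * of_real pi *
     ((\<Sum>k. - (of_real pi / sin (of_real pi * \<nu>)) * bessel_coeff L \<nu> k) +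
      (\<Sum>k. exp (- (L * \<nu>)) * (of_real pi / sin (of_real pi * \<nu>) * bessel_coeff L (- \<nu>) k)))"
    by (simp only: LIMSEQ_const_iff add_0_left)
  also have "(\<Sum>k. - (of_real pi / sin (of_real pi * \<nu>)) * bessel_coeff L \<nu> k) =
             - (of_real pi / sin (of_real pi * \<nu>)) * (\<Sum>k. bessel_coeff L \<nu> k)"
    by (rule suminf_mult[OF summ(1)])
  also have "(\<Sum>k. exp (- (L * \<nu>)) * (of_real pi / sin (of_real pi * \<nu>) * bessel_coeff L (- \<nu>) k)) =
             exp (- (L * \<nu>)) * (of_real pi / sin (of_real pi * \<nu>) * (\<Sum>k. bessel_coeff L (- \<nu>) k))"
    by (simp only: suminf_mult summ summable_mult)
  finally show ?thesis unfolding bessel_K_exp_nonint[OF L \<nu>] by simp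
qed

section \<open>Integer orders by continuity\<close>

lemma tendsto_mb_integral:
  assumes L: "\<bar>Im L\<bar> \<le> pi / 2" and c: "c > max 0 (Re \<nu>)"
  shows "((\<lambda>\<mu>. LINT t|lborel. mb_kernel L \<mu> (Complex c t)) \<longlongrightarrow>
           (LINT t|lborel. mb_kernel L \<nu> (Complex c t))) (at \<nu>)"
proof (subst tendsto_at_iff_sequentially, intro allI impI)
  fix X :: "nat \<Rightarrow> complex" assume "X \<longlonglongrightarrow> \<nu>"
  \<comment> \<open>Orders within \<open>\<delta>\<close> of \<open>\<nu>\<close> keep
    \<open>c - Re \<mu>\<close> in \<open>[\<delta>, 3\<delta>]\<close>, away from the pole of
    \<open>\<Gamma>\<close> at 0; this makes the bound uniform.\<close>
  define \<delta> where "\<delta> = (c - Re \<nu>) / 2"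
  have \<delta>: "\<delta> > 0" "c - Re \<nu> = 2 * \<delta>" using c by (auto simp: \<delta>_def)
  obtain C where C: "\<And>\<mu> s. Re s = c \<and> \<delta> \<le> c - Re \<mu> \<and> c - Re \<mu> \<le> 3 * \<delta> \<and> \<bar>Im \<mu>\<bar> \<le> \<bar>Im \<nu>\<bar> + \<delta> \<Longrightarrow>
      norm (mb_kernel L \<mu> s) \<le> C * exp (- (pi / 4 * \<bar>Im s\<bar>))"
    using mb_kernel_line_bound[OF L, of c \<delta> "3 * \<delta>" "\<bar>Im \<nu>\<bar> + \<delta>"] c \<delta> by auto
  obtain n0 where n0: "\<And>n. n \<ge> n0 \<Longrightarrow> dist (X n) \<nu> < \<delta>"
    using \<open>X \<longlonglongrightarrow> \<nu>\<close> \<delta>(1) unfolding lim_sequentially by blast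
  have near: "\<delta> \<le> c - Re (X n) \<and> c - Re (X n) \<le> 3 * \<delta> \<and> \<bar>Im (X n)\<bar> \<le> \<bar>Im \<nu>\<bar> + \<delta>" if "n \<ge> n0" for n
    using abs_Re_le_cmod[of "X n - \<nu>"] abs_Im_le_cmod[of "X n - \<nu>"] n0[OF that] \<delta>(2)
    by (auto simp: dist_norm)
  have pos: "x \<notin> \<int>\<^sub>\<le>\<^sub>0" if "x > 0" for x :: real using that by (auto elim!: nonpos_Ints_cases)
  have meas: "(\<lambda>t. mb_kernel L \<mu> (Complex c t)) \<in> borel_measurable lborel" if "c > Re \<mu>" for \<mu>
    using borel_measurable_continuous_onI[OF continuous_mb_kernel_line[of c \<mu> L]] pos that c by simp
  have "(\<lambda>n. LINT t|lborel. mb_kernel L (X (n + n0)) (Complex c t)) \<longlonglongrightarrow>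
        (LINT t|lborel. mb_kernel L \<nu> (Complex c t))"
  proof (rule integral_dominated_convergence)
    show "integrable lborel (\<lambda>t. C * exp (- (pi / 4 * \<bar>t\<bar>)))"
      using integrable_exp_neg_abs[of "pi / 4"] by simp
    show "(\<lambda>t. mb_kernel L \<nu> (Complex c t)) \<in> borel_measurable lborel"
      using c by (intro meas) auto
    show "(\<lambda>t. mb_kernel L (X (n + n0)) (Complex c t)) \<in> borel_measurable lborel" for n
      using near[of "n + n0"] \<delta> by (intro meas) auto
    show "AE t in lborel. norm (mb_kernel L (X (n + n0)) (Complex c t)) \<le> C * exp (- (pi / 4 * \<bar>t\<bar>))" for n
      using near[of "n + n0"] C[of "Complex c t" "X (n + n0)" for t] by auto
    show "AE t in lborel. (\<lambda>n. mb_kernel L (X (n + n0)) (Complex c t)) \<longlonglongrightarrow> mb_kernel L \<nu> (Complex c t)"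
    proof (intro AE_I2)
      fix t
      have "Complex c t - \<nu> = Complex (c - Re \<nu>) (t - Im \<nu>)" by (simp add: complex_eq_iff)
      hence "Complex c t - \<nu> \<notin> \<int>\<^sub>\<le>\<^sub>0" using pos \<delta> Complex_in_nonpos_Ints_imp by (metis mult_pos_pos zero_less_numeral)
      hence "isCont (\<lambda>\<mu>. mb_kernel L \<mu> (Complex c t)) \<nu>"
        unfolding mb_kernel_def by (intro continuous_intros)
      thus "(\<lambda>n. mb_kernel L (X (n + n0)) (Complex c t)) \<longlonglongrightarrow> mb_kernel L \<nu> (Complex c t)"
        using isCont_tendsto_compose LIMSEQ_ignore_initial_segment[OF \<open>X \<longlonglongrightarrow> \<nu>\<close>] by blast
    qed
  qed
  thus "((\<lambda>\<mu>. LINT t|lborel. mb_kernel L \<mu> (Complex c t)) \<circ> X) \<longlonglongrightarrow>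
          (LINT t|lborel. mb_kernel L \<nu> (Complex c t))"
    unfolding o_def by (rule LIMSEQ_offset)
qed

theorem mb_integral_eq_bessel_K:
  assumes L: "\<bar>Im L\<bar> \<le> pi / 2" and c: "c > max 0 (Re \<nu>)"
  shows "(LINT t|lborel. mb_kernel L \<nu> (Complex c t)) =
           4 * of_real pi * (exp (- (L * \<nu> / 2)) * bessel_K \<nu> (2 * exp (L / 2)))"
proof (cases "\<nu> \<in> \<int>")
  case False
  thus ?thesis using assms by (intro mb_integral_nonint)
next
  case True
  define J where "J = (\<lambda>\<mu>. LINT t|lborel. mb_kernel L \<mu> (Complex c t))"
  define Q where "Q = (\<lambda>\<mu>. of_real pi / 2 * (bessel_I (- \<mu>) (2 * exp (L / 2)) - bessel_I \<mu> (2 * exp (L / 2)))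
                       / sin (of_real pi * \<mu>))"
  \<comment> \<open>Integers are isolated, so near \<open>\<nu>\<close> the non-integral case
    identifies the quotient \<open>Q\<close> with the rescaled integral.\<close>
  have "eventually (\<lambda>\<mu>. \<mu> \<notin> \<int>) (at \<nu>)"
  proof -
    have "open (- (\<int> - {\<nu>}))" by (intro open_Compl closed_subset_Ints) auto
    hence "eventually (\<lambda>\<mu>. \<mu> \<in> - (\<int> - {\<nu>}) - {\<nu>}) (at \<nu>)"
      by (intro eventually_at_in_open) auto
    thus ?thesis by eventually_elim auto
  qed
  moreover have "eventually (\<lambda>\<mu>. c > Re \<mu>) (at \<nu>)"
    using c by (intro order_tendstoD(2)[OF tendsto_Re[OF tendsto_ident_at]]) auto
  ultimately have "eventually (\<lambda>\<mu>. exp (L * \<mu> / 2) * J \<mu> / (4 * of_real pi) = Q \<mu>) (at \<nu>)"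
  proof eventually_elim
    case (elim \<mu>)
    have "J \<mu> = 4 * of_real pi * (exp (- (L * \<mu> / 2)) * Q \<mu>)"
      using mb_integral_nonint[OF L elim(1), of c] elim c
      by (simp add: J_def Q_def bessel_K_def Let_def)
    thus ?case by (simp add: exp_minus)
  qed
  moreover have "((\<lambda>\<mu>. exp (L * \<mu> / 2) * J \<mu> / (4 * of_real pi)) \<longlongrightarrow>
                   exp (L * \<nu> / 2) * J \<nu> / (4 * of_real pi)) (at \<nu>)"
    unfolding J_def by (intro tendsto_intros tendsto_mb_integral assms) auto
  ultimately have "(Q \<longlongrightarrow> exp (L * \<nu> / 2) * J \<nu> / (4 * of_real pi)) (at \<nu>)"
    by (rule Lim_transform_eventually[rotated])
  \<comment> \<open>Continuity of the integral shows that the limit defining \<open>bessel_K\<close>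
    exists, and uniqueness of limits gives its value.\<close>
  hence "Lim (at \<nu>) Q = exp (L * \<nu> / 2) * J \<nu> / (4 * of_real pi)"
    by (intro tendsto_Lim) auto
  moreover have "bessel_K \<nu> (2 * exp (L / 2)) = Lim (at \<nu>) Q"
    using True by (simp add: bessel_K_def Let_def Q_def)
  ultimately show ?thesis by (simp add: J_def exp_minus)
qed

section \<open>Evaluation of \<open>K1\<close>\<close>

text \<open>The argument is a square because only its root \<open>a\<close> appears on the right:
  halving \<open>L = 2 ln a \<plusminus> i\<pi>/2\<close> gives
  \<open>e^(L/2) = a e^(\<plusminus>i\<pi>/4)\<close>.\<close>

lemma K1_eq_bessel_K:
  fixes a c :: real and z :: complex
  assumes "a > 0" "c > max 0 (Re z)"
  shows "K1 c z (a\<^sup>2) = of_real a powr (- z) *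
      (exp (- (\<i> * of_real pi * z / 4)) * bessel_K z (2 * of_real a * exp (\<i> * of_real pi / 4))
     + exp (\<i> * of_real pi * z / 4) * bessel_K z (2 * of_real a * exp (- (\<i> * of_real pi / 4))))"
proof -
  define l where "l = complex_of_real (ln a)"
  define Lp Lm where "Lp = 2 * l + \<i> * of_real pi / 2" and "Lm = 2 * l - \<i> * of_real pi / 2"
  have L: "\<bar>Im Lp\<bar> \<le> pi / 2" "\<bar>Im Lm\<bar> \<le> pi / 2" by (simp_all add: Lp_def Lm_def l_def)
  have el: "exp l = of_real a" using assms by (simp add: l_def exp_of_real)
  have pw: "of_real a powr s = exp (s * l)" for s
    using assms by (simp add: powr_def l_def Ln_of_real)
  have pw2: "of_real (a\<^sup>2) powr (- s) = exp (- (2 * l * s))" for s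
    using assms by (simp add: powr_def l_def Ln_of_real ln_realpow mult_ac flip: of_real_power)
  have eq: "Gamma s * cos (of_real pi * s / 2) * Gamma (s - z) * of_real (a\<^sup>2) powr (- s) =
        (mb_kernel Lp z s + mb_kernel Lm z s) / 2" for s
  proof -
    \<comment> \<open>\<open>Lp\<close> takes the exponential \<open>e^(-i\<pi>s/2)\<close> of the
      cosine and \<open>Lm\<close> the other one.\<close>
    have "cos (of_real pi * s / 2) * exp (- (2 * l * s)) = (exp (- (Lp * s)) + exp (- (Lm * s))) / 2"
      by (simp add: cos_exp_eq Lp_def Lm_def algebra_simps add_divide_distrib flip: exp_add)
    thus ?thesis unfolding pw2 mb_kernel_def
      by (simp add: algebra_simps add_divide_distrib)
  qed
  have "K1 c z (a\<^sup>2) = 1 / (2 * of_real pi * \<i>) *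
      (LINT t|lborel. (mb_kernel Lp z (Complex c t) + mb_kernel Lm z (Complex c t)) / 2 * \<i>)"
    unfolding K1_def vertical_line_integral_def eq ..
  also have "(LINT t|lborel. (mb_kernel Lp z (Complex c t) + mb_kernel Lm z (Complex c t)) / 2 * \<i>) =
      ((LINT t|lborel. mb_kernel Lp z (Complex c t)) + (LINT t|lborel. mb_kernel Lm z (Complex c t))) * (\<i> / 2)"
  proof -
    have "c \<notin> \<int>\<^sub>\<le>\<^sub>0" "c - Re z \<notin> \<int>\<^sub>\<le>\<^sub>0" using assms(2) by (auto elim!: nonpos_Ints_cases)
    note int = integrable_mb_kernel_line[OF L(1) this] integrable_mb_kernel_line[OF L(2) this]
    have "(LINT t|lborel. (mb_kernel Lp z (Complex c t) + mb_kernel Lm z (Complex c t)) / 2 * \<i>) =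
          (LINT t|lborel. mb_kernel Lp z (Complex c t) + mb_kernel Lm z (Complex c t)) / 2 * \<i>"
      by (simp only: integral_mult_left_zero integral_divide_zero)
    thus ?thesis by (simp only: Bochner_Integration.integral_add[OF int] times_divide_eq_right times_divide_eq_left)
  qed
  also have "\<dots> = (4 * of_real pi * (exp (- (Lp * z / 2)) * bessel_K z (2 * exp (Lp / 2))) +
                   4 * of_real pi * (exp (- (Lm * z / 2)) * bessel_K z (2 * exp (Lm / 2)))) * (\<i> / 2)"
    using L assms(2) by (simp only: mb_integral_eq_bessel_K)
  \<comment> \<open>The constants cancel: \<open>4\<pi> (i/2) = 2\<pi>i\<close>.\<close>
  also have "1 / (2 * of_real pi * \<i>) * \<dots> =
      exp (- (Lp * z / 2)) * bessel_K z (2 * exp (Lp / 2)) + exp (- (Lm * z / 2)) * bessel_K z (2 * exp (Lm / 2))"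
    by (simp add: field_simps)
  finally have K: "K1 c z (a\<^sup>2) =
      exp (- (Lp * z / 2)) * bessel_K z (2 * exp (Lp / 2)) + exp (- (Lm * z / 2)) * bessel_K z (2 * exp (Lm / 2))" .
  have "exp (Lp / 2) = of_real a * exp (\<i> * of_real pi / 4)"
  proof -
    have "Lp / 2 = l + \<i> * of_real pi / 4" by (simp add: Lp_def field_simps)
    thus ?thesis by (simp only: exp_add el)
  qed
  moreover have "exp (Lm / 2) = of_real a * exp (- (\<i> * of_real pi / 4))"
  proof -
    have "Lm / 2 = l + - (\<i> * of_real pi / 4)" by (simp add: Lm_def field_simps)
    thus ?thesis by (simp only: exp_add el)
  qed
  moreover have "exp (- (Lp * z / 2)) = of_real a powr (- z) * exp (- (\<i> * of_real pi * z / 4))"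
  proof -
    have "- (Lp * z / 2) = - z * l + - (\<i> * of_real pi * z / 4)"
      by (simp add: Lp_def field_simps)
    thus ?thesis unfolding pw by (simp only: exp_add)
  qed
  moreover have "exp (- (Lm * z / 2)) = of_real a powr (- z) * exp (\<i> * of_real pi * z / 4)"
  proof -
    have "- (Lm * z / 2) = - z * l + \<i> * of_real pi * z / 4"
      by (simp add: Lm_def field_simps)
    thus ?thesis unfolding pw by (simp only: exp_add)
  qed
  ultimately show ?thesis
    unfolding K by (simp only: mult.assoc distrib_left)
qed

theorem theorem4p5:
  fixes x c :: real and n :: nat and z :: complex
  assumes "x > 0" and "n \<ge> 1" and "Re z < 1" and "c > max 0 (Re z)"
  shows "K1 c z (4 * pi\<^sup>2 * real n * x) =
    of_real (2 * pi * sqrt (real n * x)) powr (- z) *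
      (exp (- (\<i> * of_real pi * z / 4)) *
         bessel_K z (4 * of_real pi * exp (\<i> * of_real pi / 4) * of_real (sqrt (real n * x)))
     + exp (\<i> * of_real pi * z / 4) *
         bessel_K z (4 * of_real pi * exp (- (\<i> * of_real pi / 4)) * of_real (sqrt (real n * x))))"
proof -
  \<comment> \<open>This is the positive square root of \<open>4\<pi>^2 n x\<close>, so
    \<open>2a\<close> gives the factor \<open>4\<pi> sqrt (nx)\<close> in the Bessel
    arguments.\<close>
  define a where "a = 2 * pi * sqrt (real n * x)"
  have "a > 0" using assms by (simp add: a_def)
  note K = K1_eq_bessel_K[OF this assms(4)]
  have sq: "a\<^sup>2 = 4 * pi\<^sup>2 * real n * x"
    using assms by (simp add: a_def power_mult_distrib)
  have arg: "2 * of_real a * w = 4 * of_real pi * w * of_real (sqrt (real n * x))" for w :: complex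
    by (simp add: a_def)
  show ?thesis
    using K unfolding sq arg unfolding a_def .
qed

end
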